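(* With the notation of the context, the Schützenberger group $\mathcal{G}$ of $H$ is defined by the monoid presentation with generators $B$ (where $b[\lambda,a]$ represents $p_\lambda a p'_{\lambda\cdot a}/\sigma$) and relations (R1) $\phi(\lambda,u)=\phi(\lambda,v)$, for $\lambda\in\Lambda$, $(u=v)\in\mathfrak{R}$, $\lambda\cdot u\neq0$; (R2) $\phi(\lambda,\kappa(u,j))=\phi(\lambda,\kappa(v,j))$, for $\lambda\in\Lambda$, $j\in J$, $(u=v)\in\mathfrak{R}$ with $u*j\ne 0$ and $H_\lambda\subseteq Sr_{u*j}$; (R3) $b[\lambda,a]=\phi(1,\kappa(\pi(b[\lambda,a]),\omega))$, for $\lambda\in\Lambda$, $a\in A$, $\lambda\cdot a\neq0$; (R4) $1=\phi(1,\kappa(h,\eta))$.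
   Context: Let $S$ be a monoid defined by a monoid presentation $\langle A\mid\mathfrak{R}\rangle$, where $\mathfrak{R}\subseteq A^*\times A^*$ and a rule $(u,v)$ is written $u=v$. For words, $\equiv$ means identical as words and $=$ means representing the same element of the monoid; words of $A^*$ also denote the elements of $S$ they represent; $1$ also denotes the empty word. $\mathscr{R},\mathscr{L},\mathscr{H}=\mathscr{R}\cap\mathscr{L}$ are Green's relations. $H$ is a fixed $\mathscr{H}$-class of $S$ and $R$ the $\mathscr{R}$-class containing it. $\mathrm{Stab}(H)=\{s\in S:Hs=H\}$; $(s,t)\in\sigma$ iff $xs=xt$ for all $x\in H$; $\mathcal{G}=\mathrm{Stab}(H)/\sigma$ is the (right) Schützenberger group of $H$. Fix a word $h\in A^*$ representing an element of $H$. Let $\{H_\lambda:\lambda\in\Lambda\}$ be the set of all $\mathscr{H}$-classes in $R$, with a distinguished $1\in\Lambda$, $H_1=H$. Fix words $p_\lambda,p'_\lambda\in A^*$ with $Hp_\lambda=H_\lambda$, $h_1p_\lambda p'_\lambda=h_1$, $h_2p'_\lambda p_\lambda=h_2$ for all $h_1\in H$, $h_2\in H_\lambda$, and $p_1\equiv p_1'\equiv1$. $S$ acts on the right of $\Lambda\cup\{0\}$: $\lambda\cdot s=\mu$ if $H_\lambda s=H_\mu$ with $\mu\in\Lambda$, and $\lambda\cdot s=0$ otherwise. Let $B=\{b[\lambda,a]:\lambda\in\Lambda,a\in A,\lambda\cdot a\neq0\}$ be an abstract set of letters. For $\lambda\cdot w\neq0$ ($w\in A^*$) define $\phi(\lambda,w)\in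 B^*$ by $\phi(\lambda,1)=1$, $\phi(\lambda,aw)=b[\lambda,a]\,\phi(\lambda\cdot a,w)$. Let $\pi:B^*\to A^*$ be a homomorphism such that $\pi(b[\lambda,a])$ is a chosen word with $hp_\lambda ap'_{\lambda\cdot a}=\pi(b[\lambda,a])h$ in $S$. $S$ acts on the left of $S/\mathscr{R}$ by $s*R'=R''$ iff $sR'\subseteq R''$. Let $\{R_i:i\in I\}$ be the inverse orbit $\{R':\exists s\in S,\ s*R'=R\}$; $S$ acts on $I\cup\{0\}$ by $s*i=j$ if $j\in I$ and $s*R_i=R_j$, and $s*i=0$ otherwise. Let $e\in A^*$ be a fixed word with $xe=x$ in $S$ for all $x\in H$ (not necessarily idempotent). Let $\omega,\eta\in I$ be the indices with $R_\omega=R$ and $e\in R_\eta$. For each $i\in I$ fix a word $r_i$ representing an element of $R_i$; the choices are assumed to satisfy $r_\omega\equiv h$, $r_\eta\equiv e$, and $r_{i}\equiv1$ for the index $i$ of the $\mathscr{R}$-class of $1_S$. For $a\in A$, $i\in I$ with $a*i\neq0$ fix a word $\kappa(a,i)\in A^*$ with $ar_i=r_{a*i}\kappa(a,i)$ in $S$, and for $w*i\ne0$ define $\kappa(w,i)$ by $\kappa(1,i)=1$, $\kappa(wa,i)=\kappa(w,a*i)\kappa(a,i)$. Let $\{R_k:k\in K\}=\{s*R_\eta:s\in S\}$ be the orbit of $R_\eta$ and $J=I\cap K$, i.e. the set of $j\in I$ with $R_j=s*R_\eta$ for some $s\in S$. *)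

theory Defs
  imports "HOL-Algebra.Coset"
begin

section \<open>Monoid presentations\<close>

definition word_val :: "('m, 'n) monoid_scheme \<Rightarrow> ('x \<Rightarrow> 'm) \<Rightarrow> 'x list \<Rightarrow> 'm" where
  "word_val M g w = foldr (\<lambda>x y. g x \<otimes>\<^bsub>M\<^esub> y) w \<one>\<^bsub>M\<^esub>"

inductive_set mon_cong :: "'x set \<Rightarrow> ('x list \<times> 'x list) set \<Rightarrow> ('x list \<times> 'x list) set"
  for X :: "'x set" and Q :: "('x list \<times> 'x list) set" where
  rule: "(u, v) \<in> Q \<Longrightarrow> (u, v) \<in> mon_cong X Q"
| refl: "w \<in> lists X \<Longrightarrow> (w, w) \<in> mon_cong X Q"
| sym: "(u, v) \<in> mon_cong X Q \<Longrightarrow> (v, u) \<in> mon_cong X Q"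
| trans: "(u, v) \<in> mon_cong X Q \<Longrightarrow> (v, w) \<in> mon_cong X Q \<Longrightarrow> (u, w) \<in> mon_cong X Q"
| append: "(u, v) \<in> mon_cong X Q \<Longrightarrow> (u', v') \<in> mon_cong X Q \<Longrightarrow>
    (u @ u', v @ v') \<in> mon_cong X Q"

text \<open>The monoid \<open>M\<close> is defined by the presentation with generators \<open>X\<close> and relations \<open>Q\<close>,
  the letter \<open>x\<close> representing \<open>g x\<close>: evaluation of words induces an isomorphism from the
  quotient of the free monoid by the congruence generated by \<open>Q\<close> onto \<open>M\<close>.\<close>

definition defined_by_presentation ::
  "('m, 'n) monoid_scheme \<Rightarrow> ('x \<Rightarrow> 'm) \<Rightarrow> 'x set \<Rightarrow> ('x list \<times> 'x list) set \<Rightarrow> bool" where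
  "defined_by_presentation M g X Q \<longleftrightarrow>
     monoid M \<and> g \<in> X \<rightarrow> carrier M \<and> Q \<subseteq> lists X \<times> lists X \<and>
     word_val M g ` lists X = carrier M \<and>
     (\<forall>u\<in>lists X. \<forall>v\<in>lists X. word_val M g u = word_val M g v \<longleftrightarrow> (u, v) \<in> mon_cong X Q)"


section \<open>Green's relations and the Schuetzenberger group\<close>

definition green_R :: "('s, 'm) monoid_scheme \<Rightarrow> ('s \<times> 's) set" where
  "green_R S = {(x, y). x \<in> carrier S \<and> y \<in> carrier S \<and>
     x <#\<^bsub>S\<^esub> carrier S = y <#\<^bsub>S\<^esub> carrier S}"

definition green_L :: "('s, 'm) monoid_scheme \<Rightarrow> ('s \<times> 's) set" where
  "green_L S = {(x, y). x \<in> carrier S \<and> y \<in> carrier S \<and>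
     carrier S #>\<^bsub>S\<^esub> x = carrier S #>\<^bsub>S\<^esub> y}"

definition green_H :: "('s, 'm) monoid_scheme \<Rightarrow> ('s \<times> 's) set" where
  "green_H S = green_R S \<inter> green_L S"

definition Stab :: "('s, 'm) monoid_scheme \<Rightarrow> 's set \<Rightarrow> 's set" where
  "Stab S H = {s \<in> carrier S. H #>\<^bsub>S\<^esub> s = H}"

definition sigma :: "('s, 'm) monoid_scheme \<Rightarrow> 's set \<Rightarrow> ('s \<times> 's) set" where
  "sigma S H = {(s, t). s \<in> Stab S H \<and> t \<in> Stab S H \<and>
     (\<forall>x\<in>H. x \<otimes>\<^bsub>S\<^esub> s = x \<otimes>\<^bsub>S\<^esub> t)}"

definition schutzenberger :: "('s, 'm) monoid_scheme \<Rightarrow> 's set \<Rightarrow> 's set monoid" where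
  "schutzenberger S H =
     \<lparr>carrier = Stab S H // sigma S H,
      mult = (\<lambda>X Y. \<Union>x\<in>X. \<Union>y\<in>Y. sigma S H `` {x \<otimes>\<^bsub>S\<^esub> y}),
      one = sigma S H `` {\<one>\<^bsub>S\<^esub>}\<rparr>"


section \<open>The actions on indices\<close>

text \<open>The element \<open>0\<close> adjoined to an index set is encoded as \<open>None\<close>.\<close>

definition H_act ::
  "('s, 'm) monoid_scheme \<Rightarrow> 'l set \<Rightarrow> ('l \<Rightarrow> 's set) \<Rightarrow> 'l \<Rightarrow> 's \<Rightarrow> 'l option" where
  "H_act S \<Lambda> Hc l s =
     (if \<exists>\<mu>\<in>\<Lambda>. Hc l #>\<^bsub>S\<^esub> s = Hc \<mu> then Some (THE \<mu>. \<mu> \<in> \<Lambda> \<and> Hc l #>\<^bsub>S\<^esub> s = Hc \<mu>) else None)"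

definition R_star :: "('s, 'm) monoid_scheme \<Rightarrow> 's \<Rightarrow> 's set \<Rightarrow> 's set" where
  "R_star S s R' = (THE R''. R'' \<in> carrier S // green_R S \<and> s <#\<^bsub>S\<^esub> R' \<subseteq> R'')"

definition R_act ::
  "('s, 'm) monoid_scheme \<Rightarrow> 'i set \<Rightarrow> ('i \<Rightarrow> 's set) \<Rightarrow> 's \<Rightarrow> 'i \<Rightarrow> 'i option" where
  "R_act S I Rc s i =
     (if \<exists>j\<in>I. R_star S s (Rc i) = Rc j then Some (THE j. j \<in> I \<and> R_star S s (Rc i) = Rc j) else None)"


section \<open>The rewriting maps\<close>

text \<open>The letter \<open>b[l,a]\<close> is the pair \<open>(l, a)\<close>. The values of \<open>phi_word\<close> and \<open>kappa_word\<close> are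
  meaningful only if \<open>dot l w\<close>, respectively \<open>star w i\<close>, differs from \<open>None\<close>; then all the
  arguments of \<open>the\<close> below differ from \<open>None\<close> as well.\<close>

primrec phi_word :: "('l \<Rightarrow> 'a list \<Rightarrow> 'l option) \<Rightarrow> 'l \<Rightarrow> 'a list \<Rightarrow> ('l \<times> 'a) list" where
  "phi_word dot l [] = []"
| "phi_word dot l (a # w) = (l, a) # phi_word dot (the (dot l [a])) w"

function kappa_word ::
  "('a list \<Rightarrow> 'i \<Rightarrow> 'i option) \<Rightarrow> ('a \<Rightarrow> 'i \<Rightarrow> 'a list) \<Rightarrow> 'a list \<Rightarrow> 'i \<Rightarrow> 'a list" where
  "kappa_word star k [] i = []"
| "kappa_word star k (w @ [a]) i = kappa_word star k w (the (star [a] i)) @ k a i"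
  by (auto, metis rev_exhaust)
termination by (relation "measure (\<lambda>(star, k, w, i). length w)") auto

end

theory Submission
  imports Defs
begin

text \<open>
  Since \<open>w r\<^sub>i = r\<^bsub>w*i\<^esub> \<kappa>(w, i)\<close>, the map \<open>\<kappa>\<close> converts left
  multiplication into right multiplication. By (R3) a word \<open>w\<close> over \<open>B\<close> is congruent to
  \<open>\<phi>(1, \<kappa>(\<pi> w, \<omega>))\<close>, and by (R4) to \<open>\<phi>(1, \<kappa>(\<pi>(w) h, \<eta>))\<close>. The element \<open>\<pi>(w) h\<close> of \<open>S\<close> depends only
  on the element of the Schuetzenberger group represented by \<open>w\<close>, so for two words with the same
  value the words \<open>\<pi>(w) h\<close> are linked by a derivation over the presentation of \<open>S\<close>, and each step
  of this derivation is turned by \<open>\<phi>(1, \<kappa>(_, \<eta>))\<close> into an application of (R2).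
\<close>


section \<open>Words and presentations\<close>

context monoid
begin

lemma word_val_Nil [simp]: "word_val G g [] = \<one>"
  by (simp add: word_val_def)

lemma word_val_Cons [simp]: "word_val G g (x # w) = g x \<otimes> word_val G g w"
  by (simp add: word_val_def)

lemma word_val_closed [intro]:
  "g \<in> X \<rightarrow> carrier G \<Longrightarrow> w \<in> lists X \<Longrightarrow> word_val G g w \<in> carrier G"
  by (induction w) auto

lemma word_val_append:
  assumes "g \<in> X \<rightarrow> carrier G" "u \<in> lists X" "v \<in> lists X"
  shows "word_val G g (u @ v) = word_val G g u \<otimes> word_val G g v"
  using assms(2)
proof (induction u)
  case Nil
  then show ?case using word_val_closed[OF assms(1,3)] by simp
next
  case (Cons x u)
  then have "g x \<in> carrier G" "word_val G g u \<in> carrier G" "word_val G g v \<in> carrier G"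
    using assms by auto
  with Cons show ?case by (simp add: m_assoc)
qed

lemma mon_cong_word_val:
  assumes g: "g \<in> X \<rightarrow> carrier G" and Q: "Q \<subseteq> lists X \<times> lists X"
    and rel: "\<And>u v. (u, v) \<in> Q \<Longrightarrow> word_val G g u = word_val G g v"
    and uv: "(u, v) \<in> mon_cong X Q"
  shows "u \<in> lists X \<and> v \<in> lists X \<and> word_val G g u = word_val G g v"
  using uv
proof induction
  case (append u v u' v')
  then show ?case by (simp add: word_val_append[OF g])
qed (use Q rel in auto)

end


section \<open>Green's relations\<close>

context monoid
begin

lemma green_R_iff:
  "(x, y) \<in> green_R G \<longleftrightarrow> x \<in> carrier G \<and> y \<in> carrier G \<and>
     (\<exists>s\<in>carrier G. y = x \<otimes> s) \<and> (\<exists>t\<in>carrier G. x = y \<otimes> t)" (is "_ \<longleftrightarrow> ?rhs")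
proof -
  have sub: "a <# carrier G \<subseteq> b <# carrier G"
    if "b \<in> carrier G" "s \<in> carrier G" "a = b \<otimes> s" for a b s
    using that by (force simp: l_coset_def m_assoc)
  have "\<exists>s\<in>carrier G. a = b \<otimes> s" if "a \<in> carrier G" "a <# carrier G = b <# carrier G" for a b
  proof -
    have "a \<otimes> \<one> \<in> a <# carrier G" by (auto simp: l_coset_def)
    with that show ?thesis by (auto simp: l_coset_def)
  qed
  note mult = this
  show ?thesis
  proof
    assume "(x, y) \<in> green_R G"
    then have "x \<in> carrier G" "y \<in> carrier G" "x <# carrier G = y <# carrier G"
      by (simp_all add: green_R_def)
    with mult[of x y] mult[of y x] show "?rhs" by simp
  next
    assume ?rhs
    then obtain s t where "x \<in> carrier G" "y \<in> carrier G" "s \<in> carrier G" "t \<in> carrier G"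
      and "y = x \<otimes> s" "x = y \<otimes> t"
      by (elim conjE bexE) (rule that)
    then have "x <# carrier G = y <# carrier G" by (intro equalityI sub)
    with \<open>x \<in> carrier G\<close> \<open>y \<in> carrier G\<close> show "(x, y) \<in> green_R G"
      by (simp add: green_R_def)
  qed
qed

lemma green_L_iff:
  "(x, y) \<in> green_L G \<longleftrightarrow> x \<in> carrier G \<and> y \<in> carrier G \<and>
     (\<exists>s\<in>carrier G. y = s \<otimes> x) \<and> (\<exists>t\<in>carrier G. x = t \<otimes> y)" (is "_ \<longleftrightarrow> ?rhs")
proof -
  have sub: "carrier G #> a \<subseteq> carrier G #> b"
    if "b \<in> carrier G" "s \<in> carrier G" "a = s \<otimes> b" for a b s
    using that by (auto simp: r_coset_def m_assoc[symmetric])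
  have "\<exists>s\<in>carrier G. a = s \<otimes> b" if "a \<in> carrier G" "carrier G #> a = carrier G #> b" for a b
  proof -
    have "\<one> \<otimes> a \<in> carrier G #> a" by (force simp: r_coset_def)
    with that show ?thesis by (auto simp: r_coset_def)
  qed
  note mult = this
  show ?thesis
  proof
    assume "(x, y) \<in> green_L G"
    then have "x \<in> carrier G" "y \<in> carrier G" "carrier G #> x = carrier G #> y"
      by (simp_all add: green_L_def)
    with mult[of x y] mult[of y x] show "?rhs" by simp
  next
    assume ?rhs
    then obtain s t where "x \<in> carrier G" "y \<in> carrier G" "s \<in> carrier G" "t \<in> carrier G"
      and "y = s \<otimes> x" "x = t \<otimes> y"
      by (elim conjE bexE) (rule that)
    then have "carrier G #> x = carrier G #> y" by (intro equalityI sub)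
    with \<open>x \<in> carrier G\<close> \<open>y \<in> carrier G\<close> show "(x, y) \<in> green_L G"
      by (simp add: green_L_def)
  qed
qed

lemma equiv_green_R: "equiv (carrier G) (green_R G)"
  by (auto intro!: equivI refl_onI symI transI simp: green_R_def)

lemma equiv_green_H: "equiv (carrier G) (green_H G)"
  by (auto intro!: equivI refl_onI symI transI simp: green_H_def green_R_def green_L_def)

lemma green_RE:
  assumes "(x, y) \<in> green_R G"
  obtains s t where "x \<in> carrier G" "s \<in> carrier G" "t \<in> carrier G" "y = x \<otimes> s" "x \<otimes> s \<otimes> t = x"
  using assms unfolding green_R_iff by (elim conjE bexE) (metis that)

lemma green_RI:
  "x \<in> carrier G \<Longrightarrow> s \<in> carrier G \<Longrightarrow> t \<in> carrier G \<Longrightarrow> x \<otimes> s \<otimes> t = x \<Longrightarrow>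
    (x, x \<otimes> s) \<in> green_R G"
  unfolding green_R_iff by (metis m_closed)

lemma green_LE:
  assumes "(x, y) \<in> green_L G"
  obtains s t where "x \<in> carrier G" "s \<in> carrier G" "t \<in> carrier G" "y = s \<otimes> x" "t \<otimes> (s \<otimes> x) = x"
  using assms unfolding green_L_iff by (elim conjE bexE) (metis that)

lemma green_LI:
  "x \<in> carrier G \<Longrightarrow> s \<in> carrier G \<Longrightarrow> t \<in> carrier G \<Longrightarrow> t \<otimes> (s \<otimes> x) = x \<Longrightarrow>
    (x, s \<otimes> x) \<in> green_L G"
  unfolding green_L_iff by (metis m_closed)

lemma green_R_mult_left:
  assumes "(x, y) \<in> green_R G" "s \<in> carrier G"
  shows "(s \<otimes> x, s \<otimes> y) \<in> green_R G"
  using assms(1)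
proof (rule green_RE)
  fix a b
  assume c: "x \<in> carrier G" "a \<in> carrier G" "b \<in> carrier G" and y: "y = x \<otimes> a"
    and x: "x \<otimes> a \<otimes> b = x"
  have "s \<otimes> x \<otimes> a \<otimes> b = s \<otimes> (x \<otimes> a \<otimes> b)" using c assms(2) by (simp add: m_assoc)
  with green_RI[of "s \<otimes> x" a b] show ?thesis using c assms(2) by (simp add: x y m_assoc)
qed

lemma green_L_mult_right:
  assumes "(x, y) \<in> green_L G" "s \<in> carrier G"
  shows "(x \<otimes> s, y \<otimes> s) \<in> green_L G"
  using assms(1)
proof (rule green_LE)
  fix a b
  assume c: "x \<in> carrier G" "a \<in> carrier G" "b \<in> carrier G" and y: "y = a \<otimes> x"
    and x: "b \<otimes> (a \<otimes> x) = x"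
  have "b \<otimes> (a \<otimes> (x \<otimes> s)) = b \<otimes> (a \<otimes> x) \<otimes> s" using c assms(2) by (simp add: m_assoc)
  with green_LI[of "x \<otimes> s" a b] show ?thesis using c assms(2) by (simp add: x y m_assoc)
qed

lemma R_star_eq:
  assumes R': "R' \<in> carrier G // green_R G" and x: "x \<in> R'" and s: "s \<in> carrier G"
  shows "R_star G s R' = green_R G `` {s \<otimes> x}"
proof -
  have R'_eq: "R' = green_R G `` {x}"
    using R' x equiv_green_R by (metis equiv_class_eq_iff quotientE Image_singleton_iff)
  have xc: "x \<in> carrier G"
    using R' x in_quotient_imp_subset[OF equiv_green_R] by blast
  show ?thesis unfolding R_star_def
  proof (rule the_equality)
    show "green_R G `` {s \<otimes> x} \<in> carrier G // green_R G \<and> s <# R' \<subseteq> green_R G `` {s \<otimes> x}"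
      using s xc green_R_mult_left by (auto simp: R'_eq l_coset_def quotientI)
  next
    fix R'' assume *: "R'' \<in> carrier G // green_R G \<and> s <# R' \<subseteq> R''"
    then have "s \<otimes> x \<in> R''" using x by (auto simp: l_coset_def)
    with * show "R'' = green_R G `` {s \<otimes> x}"
      using equiv_green_R by (metis equiv_class_eq_iff quotientE Image_singleton_iff)
  qed
qed

text \<open>Green's lemma: \<open>t\<close> inverts right multiplication by \<open>s\<close> on the whole \<open>\<L>\<close>-class of \<open>x\<close>.\<close>

lemma green_H_coset:
  assumes x: "x \<in> carrier G" and s: "s \<in> carrier G" and t: "t \<in> carrier G"
    and xst: "x \<otimes> s \<otimes> t = x"
  shows "(green_H G `` {x}) #> s = green_H G `` {x \<otimes> s}"
proof -
  have R: "(x, x \<otimes> s) \<in> green_R G"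
    using green_RI x s t xst by blast
  have st_id: "y \<otimes> s \<otimes> t = y" if y: "(x, y) \<in> green_L G" for y
  proof -
    obtain c where "c \<in> carrier G" "y = c \<otimes> x" using y by (rule green_LE) (rule that)
    then have "y \<otimes> s \<otimes> t = c \<otimes> (x \<otimes> s \<otimes> t)" using x s t by (simp add: m_assoc)
    then show ?thesis using xst \<open>y = c \<otimes> x\<close> by simp
  qed
  have fwd: "y \<otimes> s \<in> green_H G `` {x \<otimes> s}" if "y \<in> green_H G `` {x}" for y
  proof -
    have y: "(x, y) \<in> green_L G" "(x, y) \<in> green_R G" using that by (auto simp: green_H_def)
    then have yc: "y \<in> carrier G" by (simp add: green_L_iff)
    have "(y, y \<otimes> s) \<in> green_R G"
      using green_RI yc s t st_id[OF y(1)] by blast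
    then have "(x \<otimes> s, y \<otimes> s) \<in> green_R G"
      using R y(2) by (auto simp: green_R_def)
    then show ?thesis
      using green_L_mult_right[OF y(1) s] by (auto simp: green_H_def)
  qed
  have "z \<in> (green_H G `` {x}) #> s" if "z \<in> green_H G `` {x \<otimes> s}" for z
  proof -
    have z: "(x \<otimes> s, z) \<in> green_L G" "(x \<otimes> s, z) \<in> green_R G"
      using that by (auto simp: green_H_def)
    then have zc: "z \<in> carrier G" by (simp add: green_L_iff)
    obtain c where c: "c \<in> carrier G" "z = c \<otimes> (x \<otimes> s)" using z(1) by (rule green_LE) (rule that)
    have "z \<otimes> t \<otimes> s = c \<otimes> (x \<otimes> s \<otimes> t) \<otimes> s" using c x s t by (simp add: m_assoc)
    then have zts: "z \<otimes> t \<otimes> s = z" using c x s xst by (simp add: m_assoc)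
    have "(x, z \<otimes> t) \<in> green_L G" using green_L_mult_right[OF z(1) t] xst by simp
    moreover have "(z \<otimes> t, z \<otimes> t \<otimes> s) \<in> green_R G"
      using green_RI[of "z \<otimes> t" s t] zc s t zts by simp
    then have "(x, z \<otimes> t) \<in> green_R G" using R z(2) zts by (auto simp: green_R_def)
    ultimately show ?thesis using zts by (force simp: green_H_def r_coset_def)
  qed
  with fwd show ?thesis by (auto simp: r_coset_def)
qed

end


section \<open>The two actions and the rewriting maps\<close>

locale schutzenberger_rewriting = monoid S
  for S :: "('s, 'm) monoid_scheme" (structure) +
  fixes A :: "'a set" and gen :: "'a \<Rightarrow> 's" and H R :: "'s set" and h e :: "'a list"
    and \<Lambda> :: "'l set" and Hc :: "'l \<Rightarrow> 's set" and l\<^sub>1 :: 'l and p p' :: "'l \<Rightarrow> 'a list"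
    and I :: "'i set" and Rc :: "'i \<Rightarrow> 's set" and \<omega> \<eta> :: 'i and r :: "'i \<Rightarrow> 'a list"
    and k :: "'a \<Rightarrow> 'i \<Rightarrow> 'a list"
  assumes gen: "gen \<in> A \<rightarrow> carrier S"
    and H: "H \<in> carrier S // green_H S"
    and R: "R \<in> carrier S // green_R S" "H \<subseteq> R"
    and h: "h \<in> lists A" "word_val S gen h \<in> H"
    and Hc: "bij_betw Hc \<Lambda> {H' \<in> carrier S // green_H S. H' \<subseteq> R}"
    and base: "l\<^sub>1 \<in> \<Lambda>" "Hc l\<^sub>1 = H"
    and p_words: "\<And>l. l \<in> \<Lambda> \<Longrightarrow> p l \<in> lists A" "\<And>l. l \<in> \<Lambda> \<Longrightarrow> p' l \<in> lists A"
    and p: "\<And>l. l \<in> \<Lambda> \<Longrightarrow> H #> word_val S gen (p l) = Hc l"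
    and pp': "\<And>l x. l \<in> \<Lambda> \<Longrightarrow> x \<in> H \<Longrightarrow> x \<otimes> word_val S gen (p l) \<otimes> word_val S gen (p' l) = x"
    and p'p: "\<And>l x. l \<in> \<Lambda> \<Longrightarrow> x \<in> Hc l \<Longrightarrow> x \<otimes> word_val S gen (p' l) \<otimes> word_val S gen (p l) = x"
    and p1: "p l\<^sub>1 = []" "p' l\<^sub>1 = []"
    and Rc: "bij_betw Rc I {R' \<in> carrier S // green_R S. \<exists>s\<in>carrier S. R_star S s R' = R}"
    and e: "\<And>x. x \<in> H \<Longrightarrow> x \<otimes> word_val S gen e = x"
    and \<omega>: "\<omega> \<in> I" "Rc \<omega> = R"
    and \<eta>: "\<eta> \<in> I"
    and r: "\<And>i. i \<in> I \<Longrightarrow> r i \<in> lists A" "\<And>i. i \<in> I \<Longrightarrow> word_val S gen (r i) \<in> Rc i"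
    and r_choice: "r \<omega> = h" "r \<eta> = e"
    and k_words: "\<And>a i. a \<in> A \<Longrightarrow> i \<in> I \<Longrightarrow> R_act S I Rc (word_val S gen [a]) i \<noteq> None \<Longrightarrow>
          k a i \<in> lists A"
    and k: "\<And>a i. a \<in> A \<Longrightarrow> i \<in> I \<Longrightarrow> R_act S I Rc (word_val S gen [a]) i \<noteq> None \<Longrightarrow>
          word_val S gen (a # r i) =
          word_val S gen (r (the (R_act S I Rc (word_val S gen [a]) i)) @ k a i)"
begin

abbreviation val :: "'a list \<Rightarrow> 's" where
  "val \<equiv> word_val S gen"

abbreviation dot :: "'l \<Rightarrow> 'a list \<Rightarrow> 'l option" where
  "dot \<equiv> \<lambda>l w. H_act S \<Lambda> Hc l (val w)"

abbreviation star :: "'a list \<Rightarrow> 'i \<Rightarrow> 'i option" where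
  "star \<equiv> \<lambda>w i. R_act S I Rc (val w) i"

abbreviation \<phi> :: "'l \<Rightarrow> 'a list \<Rightarrow> ('l \<times> 'a) list" where
  "\<phi> \<equiv> phi_word dot"

abbreviation \<kappa> :: "'a list \<Rightarrow> 'i \<Rightarrow> 'a list" where
  "\<kappa> \<equiv> kappa_word star k"

abbreviation B :: "('l \<times> 'a) set" where
  "B \<equiv> {(l, a). l \<in> \<Lambda> \<and> a \<in> A \<and> dot l [a] \<noteq> None}"

abbreviation J :: "'i set" where
  "J \<equiv> {j \<in> I. \<exists>s\<in>carrier S. Rc j = R_star S s (Rc \<eta>)}"

abbreviation bval :: "'l \<times> 'a \<Rightarrow> 's set" where
  "bval \<equiv> \<lambda>(l, a). sigma S H `` {val (p l @ [a] @ p' (the (dot l [a])))}"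

lemmas val_closed [simp] = word_val_closed[OF gen]
lemmas val_append = word_val_append[OF gen]

lemma R_carrier: "x \<in> R \<Longrightarrow> x \<in> carrier S"
  using R(1) in_quotient_imp_subset[OF equiv_green_R] by blast

lemma R_related: "x \<in> R \<Longrightarrow> y \<in> R \<Longrightarrow> (x, y) \<in> green_R S"
  using R(1) quotient_eq_iff[OF equiv_green_R, of R R x y] by blast

lemma R_closed: "x \<in> R \<Longrightarrow> (x, y) \<in> green_R S \<Longrightarrow> y \<in> R"
  using R(1) in_quotient_imp_closed[OF equiv_green_R] by blast

lemma R_related_mult:
  assumes "x \<in> R" "x \<otimes> s \<in> R" "s \<in> carrier S"
  shows "x \<in> carrier S" "\<exists>t\<in>carrier S. x \<otimes> s \<otimes> t = x"
  using R_related[OF assms(1,2)] unfolding green_R_iff by metis+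

lemma Hc_sub: "l \<in> \<Lambda> \<Longrightarrow> x \<in> Hc l \<Longrightarrow> x \<in> R"
  and Hc_quotient: "l \<in> \<Lambda> \<Longrightarrow> Hc l \<in> carrier S // green_H S"
  using bij_betwE[OF Hc] by auto

lemma Hc_eq: "l \<in> \<Lambda> \<Longrightarrow> x \<in> Hc l \<Longrightarrow> Hc l = green_H S `` {x}"
  by (metis Hc_quotient Image_singleton_iff equiv_class_eq_iff equiv_green_H quotientE)

lemma Hc_inj: "l \<in> \<Lambda> \<Longrightarrow> m \<in> \<Lambda> \<Longrightarrow> Hc l = Hc m \<Longrightarrow> l = m"
  using bij_betw_imp_inj_on[OF Hc] by (rule inj_onD)

lemma Hc_ex:
  assumes "x \<in> R"
  shows "\<exists>l\<in>\<Lambda>. x \<in> Hc l"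
proof -
  have "green_H S `` {x} \<subseteq> R" using R_closed[OF assms] by (auto simp: green_H_def)
  moreover have "green_H S `` {x} \<in> carrier S // green_H S"
    using R_carrier[OF assms] by (rule quotientI)
  ultimately have "green_H S `` {x} \<in> Hc ` \<Lambda>"
    using bij_betw_imp_surj_on[OF Hc] by blast
  moreover have "x \<in> green_H S `` {x}"
    using R_carrier[OF assms] equiv_green_H by (rule equiv_class_self[rotated])
  ultimately show ?thesis by auto
qed

lemma Hc_ne: "l \<in> \<Lambda> \<Longrightarrow> \<exists>x. x \<in> Hc l"
  using Hc_quotient in_quotient_imp_non_empty[OF equiv_green_H] by blast

lemma Hc_left_multiple:
  assumes "l \<in> \<Lambda>" "x \<in> Hc l" "y \<in> Hc l"
  obtains c where "c \<in> carrier S" "y = c \<otimes> x"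
proof -
  have "(x, y) \<in> green_L S" using assms Hc_eq[OF assms(1,2)] by (auto simp: green_H_def)
  then show thesis by (rule green_LE) (rule that)
qed

lemma Hc_coset:
  assumes "l \<in> \<Lambda>" "x \<in> Hc l" "s \<in> carrier S" "m \<in> \<Lambda>" "x \<otimes> s \<in> Hc m"
  shows "Hc l #> s = Hc m"
proof -
  have "x \<in> R" "x \<otimes> s \<in> R" using assms Hc_sub by auto
  then obtain t where "t \<in> carrier S" "x \<otimes> s \<otimes> t = x" "x \<in> carrier S"
    using R_related_mult assms(3) by blast
  then have "(green_H S `` {x}) #> s = green_H S `` {x \<otimes> s}"
    using green_H_coset assms(3) by blast
  then show ?thesis using Hc_eq assms by metis
qed

lemma H_act_iff:
  assumes l: "l \<in> \<Lambda>" "x \<in> Hc l" and s: "s \<in> carrier S"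
  shows "H_act S \<Lambda> Hc l s = Some m \<longleftrightarrow> m \<in> \<Lambda> \<and> x \<otimes> s \<in> Hc m"
proof -
  have "x \<otimes> s \<in> Hc l #> s" using l by (auto simp: r_coset_def)
  then have *: "Hc l #> s = Hc n \<longleftrightarrow> x \<otimes> s \<in> Hc n" if "n \<in> \<Lambda>" for n
    using Hc_coset[OF l s that] by auto
  have uniq: "(THE n. n \<in> \<Lambda> \<and> Hc l #> s = Hc n) = n" if "n \<in> \<Lambda>" "Hc l #> s = Hc n" for n
    by (rule the_equality) (use that Hc_inj in auto)
  show ?thesis
    unfolding H_act_def using uniq * by auto
qed

lemma H_act_ne_iff:
  assumes l: "l \<in> \<Lambda>" "x \<in> Hc l" and s: "s \<in> carrier S"
  shows "H_act S \<Lambda> Hc l s \<noteq> None \<longleftrightarrow> x \<otimes> s \<in> R"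
  using H_act_iff[OF assms] Hc_ex Hc_sub by (metis not_None_eq)

lemma Rc_quotient: "i \<in> I \<Longrightarrow> Rc i \<in> carrier S // green_R S"
  and Rc_orbit: "i \<in> I \<Longrightarrow> \<exists>s\<in>carrier S. R_star S s (Rc i) = R"
  using bij_betwE[OF Rc] by auto

lemma Rc_carrier: "i \<in> I \<Longrightarrow> x \<in> Rc i \<Longrightarrow> x \<in> carrier S"
  using Rc_quotient in_quotient_imp_subset[OF equiv_green_R] by blast

lemma Rc_eq: "i \<in> I \<Longrightarrow> x \<in> Rc i \<Longrightarrow> Rc i = green_R S `` {x}"
  by (metis Rc_quotient Image_singleton_iff equiv_class_eq_iff equiv_green_R quotientE)

lemma Rc_right_multiple:
  assumes "i \<in> I" "x \<in> Rc i" "y \<in> Rc i"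
  shows "\<exists>t\<in>carrier S. y = x \<otimes> t"
proof -
  have "(x, y) \<in> green_R S" using assms Rc_eq[OF assms(1,2)] by blast
  then show ?thesis by (rule green_RE) blast
qed

lemma Rc_inj: "i \<in> I \<Longrightarrow> j \<in> I \<Longrightarrow> Rc i = Rc j \<Longrightarrow> i = j"
  using bij_betw_imp_inj_on[OF Rc] by (rule inj_onD)

lemma green_R_class_self: "x \<in> carrier S \<Longrightarrow> x \<in> green_R S `` {x}"
  using equiv_green_R by (rule equiv_class_self)

lemma Rc_ex:
  assumes x: "x \<in> carrier S" and q: "q \<in> carrier S" "q \<otimes> x \<in> R"
  shows "\<exists>i\<in>I. x \<in> Rc i"
proof -
  have x_in: "x \<in> green_R S `` {x}" and cl: "green_R S `` {x} \<in> carrier S // green_R S"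
    using green_R_class_self[OF x] quotientI[OF x] by blast+
  have "R_star S q (green_R S `` {x}) = R"
    using R_star_eq[OF cl x_in q(1)] Rc_eq[OF \<omega>(1)] q(2) \<omega>(2) by simp
  with q cl have "green_R S `` {x} \<in> Rc ` I"
    using bij_betw_imp_surj_on[OF Rc] by blast
  with x_in show ?thesis by auto
qed

lemma Rc_mult_R:
  assumes "i \<in> I" "x \<in> Rc i"
  shows "\<exists>q\<in>carrier S. q \<otimes> x \<in> R"
proof -
  obtain q where q: "q \<in> carrier S" "R_star S q (Rc i) = R" using Rc_orbit assms by auto
  then have "R = green_R S `` {q \<otimes> x}" using R_star_eq Rc_quotient assms by metis
  then show ?thesis using q Rc_carrier[OF assms] green_R_class_self by blast
qed

lemma R_act_iff:
  assumes i: "i \<in> I" "x \<in> Rc i" and s: "s \<in> carrier S"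
  shows "R_act S I Rc s i = Some j \<longleftrightarrow> j \<in> I \<and> s \<otimes> x \<in> Rc j"
proof -
  have "R_star S s (Rc i) = green_R S `` {s \<otimes> x}"
    using R_star_eq Rc_quotient i s by blast
  moreover have "s \<otimes> x \<in> green_R S `` {s \<otimes> x}"
    using s Rc_carrier[OF i] green_R_class_self by blast
  ultimately have *: "R_star S s (Rc i) = Rc n \<longleftrightarrow> s \<otimes> x \<in> Rc n" if "n \<in> I" for n
    using Rc_eq[OF that] by auto
  have uniq: "(THE n. n \<in> I \<and> R_star S s (Rc i) = Rc n) = n"
    if "n \<in> I" "R_star S s (Rc i) = Rc n" for n
    by (rule the_equality) (use that Rc_inj in auto)
  show ?thesis
    unfolding R_act_def using uniq * by auto
qed

lemma R_act_ne_iff: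
  assumes i: "i \<in> I" "x \<in> Rc i" and s: "s \<in> carrier S"
  shows "R_act S I Rc s i \<noteq> None \<longleftrightarrow> (\<exists>q\<in>carrier S. q \<otimes> (s \<otimes> x) \<in> R)"
  using R_act_iff[OF assms] Rc_ex[of "s \<otimes> x"] Rc_mult_R s Rc_carrier[OF i]
  by (metis m_closed not_None_eq)

lemma dot_range: "l \<in> \<Lambda> \<Longrightarrow> w \<in> lists A \<Longrightarrow> dot l w = Some m \<Longrightarrow> m \<in> \<Lambda>"
  using H_act_iff[of l _ "val w" m] Hc_ne by auto

lemma dot_Nil: "l \<in> \<Lambda> \<Longrightarrow> dot l [] = Some l"
  using H_act_iff[of l _ \<one> l] Hc_ne[of l] R_carrier[OF Hc_sub, of l] by auto

lemma dot_append:
  assumes "l \<in> \<Lambda>" "u \<in> lists A" "v \<in> lists A" "dot l u = Some n"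
  shows "dot l (u @ v) = dot n v"
proof -
  obtain x where x: "x \<in> Hc l" using Hc_ne[OF assms(1)] by blast
  then have n: "n \<in> \<Lambda>" "x \<otimes> val u \<in> Hc n" using H_act_iff assms val_closed by blast+
  have "x \<otimes> val (u @ v) = x \<otimes> val u \<otimes> val v"
    using assms x Hc_sub R_carrier by (simp add: val_append m_assoc)
  then have "dot l (u @ v) = Some m \<longleftrightarrow> dot n v = Some m" for m
    using H_act_iff[OF assms(1) x, of "val (u @ v)"] H_act_iff[OF n, of "val v"] assms by simp
  then show ?thesis by (metis option.exhaust)
qed

lemma dot_appendD:
  assumes "l \<in> \<Lambda>" "u \<in> lists A" "v \<in> lists A" "dot l (u @ v) = Some m"
  obtains n where "n \<in> \<Lambda>" "dot l u = Some n" "dot n v = Some m"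
proof -
  obtain x where x: "x \<in> Hc l" using Hc_ne[OF assms(1)] by blast
  have xc: "x \<in> R" "x \<in> carrier S" using x assms Hc_sub R_carrier by auto
  have "x \<otimes> val u \<otimes> val v \<in> R"
    using H_act_ne_iff[OF assms(1) x, of "val (u @ v)"] assms xc by (simp add: val_append m_assoc)
  then obtain t where t: "t \<in> carrier S" "x \<otimes> (val u \<otimes> val v) \<otimes> t = x"
    using R_related_mult[OF xc(1), of "val u \<otimes> val v"] assms xc by (auto simp: m_assoc)
  have "x \<otimes> val u \<otimes> (val v \<otimes> t) = x \<otimes> (val u \<otimes> val v) \<otimes> t" using t(1) assms xc by (simp add: m_assoc)
  then have "(x, x \<otimes> val u) \<in> green_R S"
    using green_RI[of x "val u" "val v \<otimes> t"] t assms xc by simp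
  then have "dot l u \<noteq> None"
    using H_act_ne_iff[OF assms(1) x, of "val u"] R_closed xc assms by simp
  then obtain n where n: "dot l u = Some n" by auto
  with that show ?thesis using dot_range dot_append assms by metis
qed

lemma star_range: "i \<in> I \<Longrightarrow> w \<in> lists A \<Longrightarrow> star w i = Some j \<Longrightarrow> j \<in> I"
  using R_act_iff[of i "val (r i)" "val w" j] r by auto

lemma star_Nil: "i \<in> I \<Longrightarrow> star [] i = Some i"
  using R_act_iff[of i "val (r i)" \<one> i] r by auto

lemma star_append:
  assumes "i \<in> I" "u \<in> lists A" "v \<in> lists A" "star v i = Some n"
  shows "star (u @ v) i = star u n"
proof -
  have n: "n \<in> I" "val v \<otimes> val (r i) \<in> Rc n"
    using R_act_iff[of i "val (r i)" "val v" n] assms r by auto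
  have "val (u @ v) \<otimes> val (r i) = val u \<otimes> (val v \<otimes> val (r i))"
    using assms r by (simp add: val_append m_assoc)
  then have "star (u @ v) i = Some m \<longleftrightarrow> star u n = Some m" for m
    using R_act_iff[of i "val (r i)" "val (u @ v)"] R_act_iff[OF n, of "val u"] assms r by simp
  then show ?thesis by (metis option.exhaust)
qed

lemma star_appendD:
  assumes "i \<in> I" "u \<in> lists A" "v \<in> lists A" "star (u @ v) i = Some m"
  obtains n where "n \<in> I" "star v i = Some n" "star u n = Some m"
proof -
  obtain q where q: "q \<in> carrier S" "q \<otimes> (val (u @ v) \<otimes> val (r i)) \<in> R"
    using R_act_ne_iff[of i "val (r i)" "val (u @ v)"] assms r by auto
  then have "(q \<otimes> val u) \<otimes> (val v \<otimes> val (r i)) \<in> R"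
    using assms r by (simp add: val_append m_assoc)
  then have "star v i \<noteq> None"
    using R_act_ne_iff[of i "val (r i)" "val v"] assms r q by (meson m_closed val_closed)
  then obtain n where n: "star v i = Some n" by auto
  with that show ?thesis using star_range star_append assms by metis
qed

lemma phi_append:
  assumes "l \<in> \<Lambda>" "u \<in> lists A" "v \<in> lists A" "dot l u = Some n"
  shows "\<phi> l (u @ v) = \<phi> l u @ \<phi> n v"
  using assms
proof (induction u arbitrary: l)
  case Nil
  then show ?case using dot_Nil by auto
next
  case (Cons a u)
  then obtain m where "m \<in> \<Lambda>" "dot l [a] = Some m" "dot m u = Some n"
    using dot_appendD[of l "[a]" u n] by auto
  then show ?case using Cons by simp
qed

lemma phi_lists:
  assumes "l \<in> \<Lambda>" "w \<in> lists A" "dot l w = Some n"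
  shows "\<phi> l w \<in> lists B"
  using assms
proof (induction w arbitrary: l)
  case (Cons a u)
  then obtain m where "m \<in> \<Lambda>" "dot l [a] = Some m" "dot m u = Some n"
    using dot_appendD[of l "[a]" u n] by auto
  then show ?case using Cons by simp
qed simp

lemma kappa_append:
  assumes "i \<in> I" "u \<in> lists A" "v \<in> lists A" "star v i = Some j"
  shows "\<kappa> (u @ v) i = \<kappa> u j @ \<kappa> v i"
  using assms
proof (induction v arbitrary: i rule: rev_induct)
  case Nil
  then show ?case using star_Nil by auto
next
  case (snoc a v)
  then obtain m where "m \<in> I" "star [a] i = Some m" "star v m = Some j"
    using star_appendD[of i v "[a]" j] by auto
  then show ?case using snoc by (simp flip: append_assoc)
qed

lemma kappa_lists_and_val:
  assumes "i \<in> I" "w \<in> lists A" "star w i = Some j"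
  shows "\<kappa> w i \<in> lists A \<and> val w \<otimes> val (r i) = val (r j) \<otimes> val (\<kappa> w i)"
  using assms
proof (induction w arbitrary: i rule: rev_induct)
  case Nil
  then show ?case using star_Nil r by auto
next
  case (snoc a w)
  then have w: "w \<in> lists A" "[a] \<in> lists A" "a \<in> A" by auto
  obtain m where m: "m \<in> I" "star [a] i = Some m" "star w m = Some j"
    using star_appendD[of i w "[a]" j] snoc by auto
  note IH = snoc.IH[OF m(1) w(1) m(3)]
  have j: "j \<in> I" using star_range m w by blast
  have ka: "k a i \<in> lists A" using k_words m snoc.prems w by auto
  have "val [a] \<otimes> val (r i) = val (r m @ k a i)"
    using k[of a i] m snoc.prems w r gen by (auto simp: Pi_iff)
  then have 1: "val [a] \<otimes> val (r i) = val (r m) \<otimes> val (k a i)"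
    using r m ka by (simp add: val_append)
  have "val (w @ [a]) \<otimes> val (r i) = val w \<otimes> (val [a] \<otimes> val (r i))"
    using w r snoc.prems m by (simp add: val_append m_assoc del: word_val_Cons)
  also have "\<dots> = val w \<otimes> val (r m) \<otimes> val (k a i)"
    unfolding 1 using w r m ka by (simp add: m_assoc)
  also have "\<dots> = val (r j) \<otimes> val (\<kappa> w m @ k a i)"
    using IH r j ka m by (simp add: m_assoc val_append)
  finally show ?case using IH ka m by simp
qed

lemmas kappa_lists = kappa_lists_and_val[THEN conjunct1]
  and kappa_val = kappa_lists_and_val[THEN conjunct2]

lemma mult_kappa:
  assumes "j \<in> I" "u \<in> lists A" "star u j = Some i" "s \<in> carrier S" "x = s \<otimes> val (r i)"
  shows "x \<otimes> val (\<kappa> u j) = s \<otimes> (val u \<otimes> val (r j))"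
proof -
  have "i \<in> I" using star_range assms by blast
  then show ?thesis
    using kappa_val[OF assms(1-3)] kappa_lists[OF assms(1-3)] assms r by (simp add: m_assoc)
qed

lemma dot_kappa:
  assumes l: "l \<in> \<Lambda>" and u: "j \<in> I" "u \<in> lists A" "star u j = Some i"
    and sub: "Hc l \<subseteq> carrier S #> val (r i)"
  obtains m where "m \<in> \<Lambda>" "dot l (\<kappa> u j) = Some m" "Hc m \<subseteq> carrier S #> val (r j)"
proof -
  have ku: "\<kappa> u j \<in> lists A" using kappa_lists u by blast
  have i: "i \<in> I" using star_range u by blast
  have val_c: "val (r i) \<in> carrier S" "val (r j) \<in> carrier S" "val u \<in> carrier S"
    "val (\<kappa> u j) \<in> carrier S"
    using r u i ku by auto
  have rep: "\<exists>s\<in>carrier S. x = s \<otimes> val (r i)" if "x \<in> Hc l" for x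
    using sub that by (auto simp: r_coset_def)
  obtain x where x: "x \<in> Hc l" using Hc_ne[OF l] by blast
  then obtain s where s: "s \<in> carrier S" "x = s \<otimes> val (r i)" using rep by blast
  have xR: "x \<in> R" "x \<in> carrier S" using x l Hc_sub R_carrier by auto
  have "val u \<otimes> val (r j) \<in> Rc i"
    using R_act_iff[of j "val (r j)" "val u" i] u r by auto
  then obtain y where y: "y \<in> carrier S" "val (r i) = val u \<otimes> val (r j) \<otimes> y"
    using Rc_right_multiple[OF i] r(2)[OF i] by blast
  have "x \<otimes> val (\<kappa> u j) \<otimes> y = x"
    unfolding mult_kappa[OF u s] using s y val_c by (simp add: m_assoc)
  then have "(x, x \<otimes> val (\<kappa> u j)) \<in> green_R S"
    using green_RI y(1) xR val_c by blast
  then have "dot l (\<kappa> u j) \<noteq> None"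
    using H_act_ne_iff[OF l x] R_closed[OF xR(1)] val_c by simp
  then obtain m where m: "dot l (\<kappa> u j) = Some m" by auto
  then have m': "m \<in> \<Lambda>" "x \<otimes> val (\<kappa> u j) \<in> Hc m" using H_act_iff l x val_c by auto
  then have "Hc m = Hc l #> val (\<kappa> u j)" using Hc_coset l x val_c by metis
  moreover have "z \<otimes> val (\<kappa> u j) \<in> carrier S #> val (r j)" if z: "z \<in> Hc l" for z
  proof -
    obtain t where t: "t \<in> carrier S" "z = t \<otimes> val (r i)" using rep z by blast
    have "z \<otimes> val (\<kappa> u j) = t \<otimes> val u \<otimes> val (r j)"
      unfolding mult_kappa[OF u t] using t val_c by (simp add: m_assoc)
    with t val_c show ?thesis by (auto simp: r_coset_def)
  qed
  ultimately have "Hc m \<subseteq> carrier S #> val (r j)" by (auto simp: r_coset_def)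
  with m m' that show ?thesis by blast
qed

lemma mult_kappa_cong:
  assumes l: "x \<in> Hc l" and u: "j \<in> I" "u \<in> lists A" "star u j = Some i"
    and sub: "Hc l \<subseteq> carrier S #> val (r i)"
    and v: "v \<in> lists A" "val u = val v"
  shows "x \<otimes> val (\<kappa> u j) = x \<otimes> val (\<kappa> v j)"
proof -
  obtain s where s: "s \<in> carrier S" "x = s \<otimes> val (r i)" using sub l by (auto simp: r_coset_def)
  have "star v j = Some i" using u v by simp
  then show ?thesis using mult_kappa[OF u s] mult_kappa[OF u(1) v(1) _ s] v by simp
qed

lemma dot_kappa_cong:
  assumes l: "l \<in> \<Lambda>" and u: "j \<in> I" "u \<in> lists A" "star u j = Some i"
    and sub: "Hc l \<subseteq> carrier S #> val (r i)"
    and v: "v \<in> lists A" "val u = val v"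
  shows "dot l (\<kappa> u j) = dot l (\<kappa> v j)"
proof -
  obtain x where x: "x \<in> Hc l" using Hc_ne[OF l] by blast
  have "star v j = Some i" using u v by simp
  then have "val (\<kappa> u j) \<in> carrier S" "val (\<kappa> v j) \<in> carrier S" using kappa_lists u v by auto
  then have "dot l (\<kappa> u j) = Some m \<longleftrightarrow> dot l (\<kappa> v j) = Some m" for m
    using H_act_iff[OF l x] mult_kappa_cong[OF x u sub v] by simp
  then show ?thesis by (metis option.exhaust)
qed


section \<open>The Schuetzenberger group\<close>

lemma H_carrier: "x \<in> H \<Longrightarrow> x \<in> carrier S"
  using R(2) R_carrier by blast

lemma Stab_iff:
  assumes "x \<in> H"
  shows "s \<in> Stab S H \<longleftrightarrow> s \<in> carrier S \<and> x \<otimes> s \<in> H"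
  using assms Hc_coset[of l\<^sub>1 x s l\<^sub>1] base by (auto simp: Stab_def r_coset_def)

lemma dot_base_Stab_iff: "w \<in> lists A \<Longrightarrow> dot l\<^sub>1 w = Some l\<^sub>1 \<longleftrightarrow> val w \<in> Stab S H"
  using H_act_iff[of l\<^sub>1 "val h" "val w" l\<^sub>1] base h Stab_iff[OF h(2)] by simp

lemma sigma_iff:
  assumes x: "x \<in> H" and "s \<in> Stab S H" "t \<in> Stab S H"
  shows "(s, t) \<in> sigma S H \<longleftrightarrow> x \<otimes> s = x \<otimes> t"
proof
  assume eq: "x \<otimes> s = x \<otimes> t"
  have "y \<otimes> s = y \<otimes> t" if y: "y \<in> H" for y
  proof -
    obtain c where "c \<in> carrier S" "y = c \<otimes> x"
      using Hc_left_multiple[of l\<^sub>1 x y] base x y by auto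
    with eq show ?thesis using assms H_carrier[OF x] by (simp add: Stab_def m_assoc)
  qed
  with assms show "(s, t) \<in> sigma S H" by (simp add: sigma_def)
qed (use x in \<open>simp add: sigma_def\<close>)

lemma equiv_sigma: "equiv (Stab S H) (sigma S H)"
  by (auto intro!: equivI refl_onI symI transI simp: sigma_def)

lemma sigma_class_eq_iff:
  assumes "x \<in> H" "s \<in> Stab S H" "t \<in> Stab S H"
  shows "sigma S H `` {s} = sigma S H `` {t} \<longleftrightarrow> x \<otimes> s = x \<otimes> t"
  using eq_equiv_class_iff[OF equiv_sigma assms(2,3)] sigma_iff[OF assms] by simp

lemma Stab_mult:
  assumes "s \<in> Stab S H" "t \<in> Stab S H"
  shows "s \<otimes> t \<in> Stab S H"
proof -
  have "val h \<otimes> s \<in> H" "s \<in> carrier S" using assms(1) h Stab_iff by blast+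
  moreover have "val h \<otimes> s \<otimes> t \<in> H" "t \<in> carrier S" using calculation assms(2) Stab_iff by blast+
  ultimately show ?thesis
    using Stab_iff[OF h(2)] h by (simp add: m_assoc)
qed

lemma Stab_one: "\<one> \<in> Stab S H"
  using Stab_iff[OF h(2)] h by simp

lemma schutzenberger_mult:
  assumes s: "s \<in> Stab S H" and t: "t \<in> Stab S H"
  shows "sigma S H `` {s} \<otimes>\<^bsub>schutzenberger S H\<^esub> sigma S H `` {t} = sigma S H `` {s \<otimes> t}"
proof -
  have "sigma S H `` {x \<otimes> y} = sigma S H `` {s \<otimes> t}"
    if x: "(s, x) \<in> sigma S H" and y: "(t, y) \<in> sigma S H" for x y
  proof -
    have xy: "x \<in> Stab S H" "y \<in> Stab S H" using x y by (auto simp: sigma_def)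
    have c: "s \<in> carrier S" "t \<in> carrier S" "x \<in> carrier S" "y \<in> carrier S"
      using s t xy by (auto simp: Stab_def)
    have "val h \<otimes> s \<in> H" using s h Stab_iff by blast
    then have "val h \<otimes> s \<otimes> t = val h \<otimes> s \<otimes> y" "val h \<otimes> s = val h \<otimes> x"
      using x y h by (auto simp: sigma_def)
    then have "val h \<otimes> (x \<otimes> y) = val h \<otimes> (s \<otimes> t)"
      using c h by (simp add: m_assoc[symmetric])
    then show ?thesis
      using sigma_class_eq_iff[OF h(2)] s t xy Stab_mult by blast
  qed
  moreover have "(s, s) \<in> sigma S H" "(t, t) \<in> sigma S H" using s t by (auto simp: sigma_def)
  ultimately have "(\<Union>x\<in>sigma S H `` {s}. \<Union>y\<in>sigma S H `` {t}. sigma S H `` {x \<otimes> y}) =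
      sigma S H `` {s \<otimes> t}"
    by (intro SUP_eq_const; blast)
  then show ?thesis by (simp add: schutzenberger_def)
qed

lemma schutzenberger_carrierE:
  assumes "X \<in> carrier (schutzenberger S H)"
  obtains s where "s \<in> Stab S H" "X = sigma S H `` {s}"
  using assms by (auto simp: schutzenberger_def elim: quotientE)

lemma schutzenberger_carrierI:
  "s \<in> Stab S H \<Longrightarrow> sigma S H `` {s} \<in> carrier (schutzenberger S H)"
  by (auto simp: schutzenberger_def quotientI)

lemma schutzenberger_one: "\<one>\<^bsub>schutzenberger S H\<^esub> = sigma S H `` {\<one>}"
  by (simp add: schutzenberger_def)

lemma Stab_carrier: "s \<in> Stab S H \<Longrightarrow> s \<in> carrier S"
  by (simp add: Stab_def)

lemma monoid_schutzenberger: "monoid (schutzenberger S H)"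
  by (rule monoidI)
    (auto elim!: schutzenberger_carrierE
      simp: schutzenberger_carrierI schutzenberger_one schutzenberger_mult Stab_mult Stab_one Stab_carrier m_assoc)

lemma p_Hc: "l \<in> \<Lambda> \<Longrightarrow> x \<in> H \<Longrightarrow> x \<otimes> val (p l) \<in> Hc l"
  using p by (auto simp: r_coset_def)

lemma p'_H:
  assumes l: "l \<in> \<Lambda>" and y: "y \<in> Hc l"
  shows "y \<otimes> val (p' l) \<in> H"
  using y pp' l p_words by (auto simp: p[OF l, symmetric] r_coset_def)

lemma Stab_conj:
  assumes "l \<in> \<Lambda>" "w \<in> lists A" "dot l w = Some m"
  shows "val (p l @ w @ p' m) \<in> Stab S H"
proof -
  have m: "m \<in> \<Lambda>" using dot_range assms by blast
  have 1: "val h \<otimes> val (p l) \<in> Hc l" using p_Hc assms h by blast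
  then have "val h \<otimes> val (p l) \<otimes> val w \<in> Hc m" using H_act_iff assms val_closed by blast
  then have "val h \<otimes> val (p l) \<otimes> val w \<otimes> val (p' m) \<in> H" using p'_H m by blast
  then show ?thesis
    using Stab_iff[OF h(2)] h assms m p_words by (simp add: val_append m_assoc)
qed

lemma bval_closed: "bval \<in> B \<rightarrow> carrier (schutzenberger S H)"
proof
  fix b assume "b \<in> B"
  then obtain l a m where "b = (l, a)" "l \<in> \<Lambda>" "[a] \<in> lists A" "dot l [a] = Some m" by auto
  then show "bval b \<in> carrier (schutzenberger S H)"
    using Stab_conj[of l "[a]" m] schutzenberger_carrierI by simp
qed

lemma phi_val:
  assumes "l \<in> \<Lambda>" "w \<in> lists A" "dot l w = Some m"
  shows "word_val (schutzenberger S H) bval (\<phi> l w) = sigma S H `` {val (p l @ w @ p' m)}"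
  using assms
proof (induction w arbitrary: l)
  case Nil
  then have m: "m = l" using dot_Nil by simp
  have "val h \<otimes> val (p l @ p' l) = val h \<otimes> \<one>"
    using Nil h pp'[of l "val h"] p_words by (simp add: val_append m_assoc)
  then have "sigma S H `` {val (p l @ p' l)} = sigma S H `` {\<one>}"
    using sigma_class_eq_iff[OF h(2)] Stab_conj[of l "[]" l] Stab_one Nil m by simp
  then show ?case by (simp add: word_val_def schutzenberger_one m)
next
  case (Cons a w)
  then have w: "[a] \<in> lists A" "w \<in> lists A" by auto
  obtain n where n: "n \<in> \<Lambda>" "dot l [a] = Some n" "dot n w = Some m"
    using dot_appendD[of l "[a]" w m] Cons by auto
  have m: "m \<in> \<Lambda>" using dot_range n w by blast
  let ?s = "val (p l @ [a] @ p' n)" and ?t = "val (p n @ w @ p' m)"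
  have st: "?s \<in> Stab S H" "?t \<in> Stab S H" "val (p l @ (a # w) @ p' m) \<in> Stab S H"
    using Stab_conj Cons.prems n w by blast+
  have c: "val h \<in> carrier S" "val (p l) \<in> carrier S" "val (p n) \<in> carrier S"
    "val (p' n) \<in> carrier S" "val (p' m) \<in> carrier S" "val w \<in> carrier S" "val [a] \<in> carrier S"
    using h p_words Cons.prems n m w by (auto simp del: word_val_Cons)
  have "val h \<otimes> val (p l) \<in> Hc l" using p_Hc Cons.prems h by blast
  then have "val h \<otimes> val (p l) \<otimes> val [a] \<in> Hc n"
    using H_act_iff Cons.prems n c by blast
  from p'p[OF n(1) this]
  have eq: "val h \<otimes> val (p l) \<otimes> val [a] \<otimes> val (p' n) \<otimes> val (p n) = val h \<otimes> val (p l) \<otimes> val [a]" .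
  have "val h \<otimes> (?s \<otimes> ?t) =
      val h \<otimes> val (p l) \<otimes> val [a] \<otimes> val (p' n) \<otimes> val (p n) \<otimes> (val w \<otimes> val (p' m))"
    using c p_words Cons.prems(1) n(1) m w
    by (simp add: val_append m_assoc del: word_val_Cons append_Cons)
  also have "\<dots> = val h \<otimes> val (p l @ [a] @ w @ p' m)"
    unfolding eq using c p_words Cons.prems(1) n(1) m w
    by (simp add: val_append m_assoc del: word_val_Cons append_Cons)
  finally have "sigma S H `` {?s \<otimes> ?t} = sigma S H `` {val (p l @ (a # w) @ p' m)}"
    using sigma_class_eq_iff[OF h(2)] st Stab_mult by simp
  then have "sigma S H `` {?s} \<otimes>\<^bsub>schutzenberger S H\<^esub> sigma S H `` {?t}
      = sigma S H `` {val (p l @ (a # w) @ p' m)}"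
    using schutzenberger_mult st by simp
  then show ?case
    using Cons.IH[OF n(1) w(2) n(3)] n
    by (simp add: monoid.word_val_Cons[OF monoid_schutzenberger] del: word_val_Cons)
qed

lemma phi_val_base:
  assumes "w \<in> lists A" "dot l\<^sub>1 w = Some l\<^sub>1"
  shows "word_val (schutzenberger S H) bval (\<phi> l\<^sub>1 w) = sigma S H `` {val w}"
  using phi_val[OF base(1) assms] p1 by simp

lemma phi_val_cong:
  assumes l: "l \<in> \<Lambda>" "x \<in> Hc l"
    and u: "u \<in> lists A" "dot l u = Some m" and v: "v \<in> lists A" "x \<otimes> val u = x \<otimes> val v"
  shows "word_val (schutzenberger S H) bval (\<phi> l u) = word_val (schutzenberger S H) bval (\<phi> l v)"
proof -
  have m: "m \<in> \<Lambda>" using dot_range l u by blast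
  have dv: "dot l v = Some m" using H_act_iff[OF l] u v by simp
  have y: "val h \<otimes> val (p l) \<in> Hc l" using p_Hc l h by blast
  then obtain c where c: "c \<in> carrier S" "val h \<otimes> val (p l) = c \<otimes> x"
    using Hc_left_multiple l by metis
  have xc: "x \<in> carrier S" using l Hc_sub R_carrier by blast
  have *: "val h \<otimes> val (p l @ w @ p' m) = c \<otimes> (x \<otimes> val w) \<otimes> val (p' m)" if "w \<in> lists A" for w
  proof -
    have "val h \<otimes> val (p l @ w @ p' m) = (val h \<otimes> val (p l)) \<otimes> val w \<otimes> val (p' m)"
      using that h p_words l m by (simp add: val_append m_assoc)
    also have "\<dots> = c \<otimes> (x \<otimes> val w) \<otimes> val (p' m)"
      unfolding c(2) using c(1) xc that by (simp add: m_assoc)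
    finally show ?thesis .
  qed
  have "val h \<otimes> val (p l @ u @ p' m) = val h \<otimes> val (p l @ v @ p' m)"
    using *[OF u(1)] *[OF v(1)] v(2) by simp
  then show ?thesis
    using phi_val[OF l(1) u] phi_val[OF l(1) v(1) dv]
      sigma_class_eq_iff[OF h(2) Stab_conj[OF l(1) u] Stab_conj[OF l(1) v(1) dv]] by simp
qed

lemma star_h: "star h \<eta> = Some \<omega>"
  using R_act_iff[of \<eta> "val (r \<eta>)" "val h" \<omega>] \<eta> r(2)[OF \<eta>] r_choice h e \<omega> R by auto

lemma \<eta>_J: "\<eta> \<in> J"
proof -
  have "R_star S \<one> (Rc \<eta>) = Rc \<eta>"
    using R_star_eq[of "Rc \<eta>" "val (r \<eta>)" \<one>] Rc_quotient r Rc_eq \<eta> by simp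
  then have "\<exists>s\<in>carrier S. Rc \<eta> = R_star S s (Rc \<eta>)" by (metis one_closed)
  with \<eta> show ?thesis by blast
qed

lemma star_J:
  assumes "j \<in> J" "w \<in> lists A" "star w j = Some i"
  shows "i \<in> J"
proof -
  obtain s where s: "s \<in> carrier S" "Rc j = R_star S s (Rc \<eta>)" and j: "j \<in> I" using assms by auto
  let ?e = "val (r \<eta>)"
  have e_in: "?e \<in> Rc \<eta>" "?e \<in> carrier S" using r \<eta> by auto
  have "s \<otimes> ?e \<in> Rc j"
    unfolding s(2) using R_star_eq[OF Rc_quotient[OF \<eta>] e_in(1) s(1)] s(1) e_in green_R_class_self
    by simp
  then have i: "i \<in> I" "val w \<otimes> (s \<otimes> ?e) \<in> Rc i"
    using R_act_iff j assms val_closed by blast+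
  have "R_star S (val w \<otimes> s) (Rc \<eta>) = green_R S `` {val w \<otimes> s \<otimes> ?e}"
    using R_star_eq Rc_quotient[OF \<eta>] e_in s assms by simp
  also have "\<dots> = Rc i" using Rc_eq[OF i] s e_in assms by (simp add: m_assoc)
  finally have "R_star S (val w \<otimes> s) (Rc \<eta>) = Rc i" .
  moreover have "val w \<otimes> s \<in> carrier S" using s assms by simp
  ultimately show ?thesis using i by blast
qed

lemma H_sub_h: "H \<subseteq> carrier S #> val h"
proof
  fix x assume "x \<in> H"
  then obtain c where "c \<in> carrier S" "x = c \<otimes> val h"
    using Hc_left_multiple[of l\<^sub>1 "val h" x] base h(2) by metis
  then show "x \<in> carrier S #> val h" by (auto simp: r_coset_def)
qed

text \<open>The induction over a derivation is possible because the pair \<open>(l, j)\<close> may vary: splitting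
  \<open>u u'\<close> turns it into \<open>(l, u'*j)\<close> for \<open>u\<close> and \<open>(l\<cdot>\<kappa>(u, u'*j), j)\<close> for \<open>u'\<close>.\<close>

lemma phi_kappa_cong:
  assumes Rules: "Rules \<subseteq> lists A \<times> lists A"
      "\<And>u v. (u, v) \<in> Rules \<Longrightarrow> val u = val v"
    and R2: "\<And>l j u v i. l \<in> \<Lambda> \<Longrightarrow> j \<in> J \<Longrightarrow> (u, v) \<in> Rules \<Longrightarrow> star u j = Some i \<Longrightarrow>
      Hc l \<subseteq> carrier S #> val (r i) \<Longrightarrow> (\<phi> l (\<kappa> u j), \<phi> l (\<kappa> v j)) \<in> mon_cong B Q"
    and uv: "(u, v) \<in> mon_cong A Rules"
    and "l \<in> \<Lambda>" "j \<in> J" "star u j = Some i" "Hc l \<subseteq> carrier S #> val (r i)"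
  shows "(\<phi> l (\<kappa> u j), \<phi> l (\<kappa> v j)) \<in> mon_cong B Q"
  using uv assms(5-)
proof (induction arbitrary: l j i)
  case (rule u v)
  then show ?case using R2 by blast
next
  case (refl w)
  then have j: "j \<in> I" by simp
  obtain m where m: "dot l (\<kappa> w j) = Some m" using dot_kappa[of l j w i] refl j by metis
  have "\<kappa> w j \<in> lists A" using kappa_lists[OF j] refl by blast
  then have "\<phi> l (\<kappa> w j) \<in> lists B" using phi_lists[OF _ _ m] refl by blast
  then show ?case by (rule mon_cong.refl)
next
  case (sym u v)
  have "val u = val v" using mon_cong_word_val[OF gen Rules sym(1)] by simp
  then have "star u j = Some i" using sym.prems by simp
  from sym.IH[OF sym.prems(1,2) this sym.prems(4)] show ?case by (rule mon_cong.sym)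
next
  case (trans u v w)
  have "val u = val v" using mon_cong_word_val[OF gen Rules trans(1)] by simp
  then have "star v j = Some i" using trans.prems by simp
  then show ?case using trans by (blast intro: mon_cong.trans)
next
  case (append u v u' v')
  have uv: "u \<in> lists A" "v \<in> lists A" "val u = val v"
    using mon_cong_word_val[OF gen Rules append(1)] by auto
  have uv': "u' \<in> lists A" "v' \<in> lists A" "val u' = val v'"
    using mon_cong_word_val[OF gen Rules append(2)] by auto
  have j: "j \<in> I" using append by simp
  obtain n where n: "n \<in> I" "star u' j = Some n" "star u n = Some i"
    using star_appendD[OF j uv(1) uv'(1) append.prems(3)] by blast
  have nJ: "n \<in> J" using star_J[OF append.prems(2) uv'(1) n(2)] .
  have n': "star v' j = Some n" "star v n = Some i" using n uv uv' by auto
  obtain m where m: "m \<in> \<Lambda>" "dot l (\<kappa> u n) = Some m" "Hc m \<subseteq> carrier S #> val (r n)"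
    using dot_kappa[OF append.prems(1) n(1) uv(1) n(3) append.prems(4)] .
  have m': "dot l (\<kappa> v n) = Some m"
    using dot_kappa_cong[OF append.prems(1) n(1) uv(1) n(3) append.prems(4) uv(2,3)] m by simp
  have kl: "\<kappa> u n \<in> lists A" "\<kappa> u' j \<in> lists A" "\<kappa> v n \<in> lists A" "\<kappa> v' j \<in> lists A"
    using kappa_lists n n' uv uv' j by blast+
  have "\<phi> l (\<kappa> (u @ u') j) = \<phi> l (\<kappa> u n) @ \<phi> m (\<kappa> u' j)"
    using kappa_append[OF j uv(1) uv'(1) n(2)] phi_append[OF append.prems(1) kl(1,2) m(2)] by simp
  moreover have "\<phi> l (\<kappa> (v @ v') j) = \<phi> l (\<kappa> v n) @ \<phi> m (\<kappa> v' j)"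
    using kappa_append[OF j uv(2) uv'(2) n'(1)] phi_append[OF append.prems(1) kl(3,4) m'] by simp
  ultimately show ?case
    using append.IH(1)[OF append.prems(1) nJ n(3) append.prems(4)]
      append.IH(2)[OF m(1) append.prems(2) n(2) m(3)]
    by (simp add: mon_cong.append)
qed

end


section \<open>The presentation\<close>

locale schutzenberger_presentation = schutzenberger_rewriting S A gen H R h e \<Lambda> Hc l\<^sub>1 p p' I Rc \<omega> \<eta> r k
  for S :: "('s, 'm) monoid_scheme" (structure)
    and A :: "'a set" and gen :: "'a \<Rightarrow> 's" and H R :: "'s set" and h e :: "'a list"
    and \<Lambda> :: "'l set" and Hc :: "'l \<Rightarrow> 's set" and l\<^sub>1 :: 'l and p p' :: "'l \<Rightarrow> 'a list"
    and I :: "'i set" and Rc :: "'i \<Rightarrow> 's set" and \<omega> \<eta> :: 'i and r :: "'i \<Rightarrow> 'a list"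
    and k :: "'a \<Rightarrow> 'i \<Rightarrow> 'a list" +
  fixes Rules :: "('a list \<times> 'a list) set" and \<pi> :: "('l \<times> 'a) list \<Rightarrow> 'a list"
  assumes S: "defined_by_presentation S gen A Rules"
    and \<pi>_hom: "\<And>u v. u \<in> lists B \<Longrightarrow> v \<in> lists B \<Longrightarrow> \<pi> (u @ v) = \<pi> u @ \<pi> v"
    and \<pi>_words: "\<And>u. u \<in> lists B \<Longrightarrow> \<pi> u \<in> lists A"
    and \<pi>: "\<And>l a. (l, a) \<in> B \<Longrightarrow>
          val (h @ p l @ [a] @ p' (the (dot l [a]))) = val (\<pi> [(l, a)] @ h)"
begin

definition relators :: "(('l \<times> 'a) list \<times> ('l \<times> 'a) list) set" where
  "relators = {(\<phi> l u, \<phi> l v) | l u v. l \<in> \<Lambda> \<and> (u, v) \<in> Rules \<and> dot l u \<noteq> None}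
      \<union> {(\<phi> l (\<kappa> u j), \<phi> l (\<kappa> v j)) | l j u v. l \<in> \<Lambda> \<and> j \<in> J \<and> (u, v) \<in> Rules \<and>
           star u j \<noteq> None \<and> Hc l \<subseteq> carrier S #> val (r (the (star u j)))}
      \<union> {([(l, a)], \<phi> l\<^sub>1 (\<kappa> (\<pi> [(l, a)]) \<omega>)) | l a. l \<in> \<Lambda> \<and> a \<in> A \<and> dot l [a] \<noteq> None}
      \<union> {([], \<phi> l\<^sub>1 (\<kappa> h \<eta>))}"

lemma Rules_lists: "Rules \<subseteq> lists A \<times> lists A"
  and val_eq_iff: "u \<in> lists A \<Longrightarrow> v \<in> lists A \<Longrightarrow> val u = val v \<longleftrightarrow> (u, v) \<in> mon_cong A Rules"
  and val_surj: "val ` lists A = carrier S"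
  using S by (auto simp: defined_by_presentation_def)

lemma Rules_val: "(u, v) \<in> Rules \<Longrightarrow> val u = val v"
  using val_eq_iff[of u v] Rules_lists mon_cong.rule by blast

lemma \<pi>_Nil: "\<pi> [] = []"
  using \<pi>_hom[of "[]" "[]"] by simp

lemma \<pi>_Cons:
  assumes "b \<in> B" "w \<in> lists B"
  shows "\<pi> (b # w) = \<pi> [b] @ \<pi> w"
proof -
  have "[b] \<in> lists B" using assms(1) by (intro lists.intros)
  from \<pi>_hom[OF this assms(2)] show ?thesis by (simp only: append_Cons append_Nil)
qed

lemma B_letter:
  assumes "(l, a) \<in> B"
  obtains m where "l \<in> \<Lambda>" "a \<in> A" "m \<in> \<Lambda>" "dot l [a] = Some m" "[a] \<in> lists A"
    "val (p l @ [a] @ p' m) \<in> Stab S H" "p l @ [a] @ p' m \<in> lists A" "[(l, a)] \<in> lists B"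
proof -
  obtain m where m: "l \<in> \<Lambda>" "a \<in> A" "dot l [a] = Some m" "[a] \<in> lists A" using assms by auto
  have "m \<in> \<Lambda>" using dot_range m by blast
  moreover have "p l @ [a] @ p' m \<in> lists A" using p_words[OF m(1)] p_words[OF \<open>m \<in> \<Lambda>\<close>] m by simp
  moreover have "[(l, a)] \<in> lists B" using assms by (intro lists.intros)
  ultimately show thesis using that m Stab_conj[of l "[a]" m] by blast
qed

lemma \<pi>_letter:
  assumes b: "(l, a) \<in> B"
  shows "star (\<pi> [(l, a)]) \<omega> = Some \<omega>"
    and "\<kappa> (\<pi> [(l, a)]) \<omega> \<in> lists A"
    and "dot l\<^sub>1 (\<kappa> (\<pi> [(l, a)]) \<omega>) = Some l\<^sub>1"
    and "word_val (schutzenberger S H) bval (\<phi> l\<^sub>1 (\<kappa> (\<pi> [(l, a)]) \<omega>)) = bval (l, a)"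
proof -
  obtain m where m: "dot l [a] = Some m" "val (p l @ [a] @ p' m) \<in> Stab S H"
    "p l @ [a] @ p' m \<in> lists A" "[(l, a)] \<in> lists B"
    using B_letter[OF b] by metis
  let ?s = "p l @ [a] @ p' m" and ?w = "\<pi> [(l, a)]"
  have w: "?w \<in> lists A" using \<pi>_words m by blast
  have "val (h @ ?s) = val (?w @ h)" using \<pi>[OF b] m by simp
  then have eq: "val ?w \<otimes> val h = val h \<otimes> val ?s"
    using val_append[OF w h(1)] val_append[OF h(1) m(3)] by simp
  have inH: "val h \<otimes> val ?s \<in> H" using m(2) Stab_iff[OF h(2)] by blast
  show star: "star ?w \<omega> = Some \<omega>"
    using R_act_iff[of \<omega> "val h" "val ?w" \<omega>] \<omega> h R w eq inH by auto
  show kl: "\<kappa> ?w \<omega> \<in> lists A" using kappa_lists[OF \<omega>(1) w star] .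
  have eq': "val h \<otimes> val (\<kappa> ?w \<omega>) = val h \<otimes> val ?s"
    using kappa_val[OF \<omega>(1) w star] eq r_choice by simp
  then have St: "val (\<kappa> ?w \<omega>) \<in> Stab S H" using Stab_iff[OF h(2)] inH kl by simp
  then show dot: "dot l\<^sub>1 (\<kappa> ?w \<omega>) = Some l\<^sub>1" using dot_base_Stab_iff kl by blast
  show "word_val (schutzenberger S H) bval (\<phi> l\<^sub>1 (\<kappa> ?w \<omega>)) = bval (l, a)"
    using phi_val_base[OF kl dot] sigma_class_eq_iff[OF h(2) St m(2)] eq' m(1) by simp
qed

lemma \<pi>_word:
  assumes "w \<in> lists B"
  shows "\<pi> w \<in> lists A" "star (\<pi> w) \<omega> = Some \<omega>" "\<kappa> (\<pi> w) \<omega> \<in> lists A"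
    "dot l\<^sub>1 (\<kappa> (\<pi> w) \<omega>) = Some l\<^sub>1"
    "(w, \<phi> l\<^sub>1 (\<kappa> (\<pi> w) \<omega>)) \<in> mon_cong B relators"
proof -
  have "star (\<pi> w) \<omega> = Some \<omega> \<and> \<kappa> (\<pi> w) \<omega> \<in> lists A \<and> dot l\<^sub>1 (\<kappa> (\<pi> w) \<omega>) = Some l\<^sub>1 \<and>
    (w, \<phi> l\<^sub>1 (\<kappa> (\<pi> w) \<omega>)) \<in> mon_cong B relators"
    using assms
  proof (induction w rule: lists.induct)
    case Nil
    then show ?case
      using star_Nil[OF \<omega>(1)] dot_Nil[OF base(1)] by (simp add: \<pi>_Nil mon_cong.refl)
  next
    case (Cons b w)
    obtain l a where b: "b = (l, a)" by (cases b)
    then have la: "(l, a) \<in> B" using Cons by blast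
    then have la': "l \<in> \<Lambda>" "a \<in> A" "dot l [a] \<noteq> None" by blast+
    have "[b] \<in> lists B" using Cons(1) by (intro lists.intros)
    note letter = \<pi>_letter[OF la, folded b]
    have words: "\<pi> [b] \<in> lists A" "\<pi> w \<in> lists A" using \<pi>_words \<open>[b] \<in> lists B\<close> Cons(2) by auto
    have split: "\<pi> (b # w) = \<pi> [b] @ \<pi> w" using \<pi>_Cons Cons by blast
    have IH: "star (\<pi> w) \<omega> = Some \<omega>" "\<kappa> (\<pi> w) \<omega> \<in> lists A"
      "dot l\<^sub>1 (\<kappa> (\<pi> w) \<omega>) = Some l\<^sub>1" "(w, \<phi> l\<^sub>1 (\<kappa> (\<pi> w) \<omega>)) \<in> mon_cong B relators"
      using Cons by blast+
    have k_split: "\<kappa> (\<pi> (b # w)) \<omega> = \<kappa> (\<pi> [b]) \<omega> @ \<kappa> (\<pi> w) \<omega>"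
      unfolding split by (rule kappa_append[OF \<omega>(1) words IH(1)])
    have phi_split: "\<phi> l\<^sub>1 (\<kappa> (\<pi> (b # w)) \<omega>) = \<phi> l\<^sub>1 (\<kappa> (\<pi> [b]) \<omega>) @ \<phi> l\<^sub>1 (\<kappa> (\<pi> w) \<omega>)"
      unfolding k_split by (rule phi_append[OF base(1) letter(2) IH(2) letter(3)])
    have "([b], \<phi> l\<^sub>1 (\<kappa> (\<pi> [b]) \<omega>)) \<in> relators"
      unfolding relators_def using la' b by blast
    then have "([b], \<phi> l\<^sub>1 (\<kappa> (\<pi> [b]) \<omega>)) \<in> mon_cong B relators" by (rule mon_cong.rule)
    from mon_cong.append[OF this IH(4)]
    have cong: "(b # w, \<phi> l\<^sub>1 (\<kappa> (\<pi> (b # w)) \<omega>)) \<in> mon_cong B relators"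
      unfolding phi_split by simp
    have "star (\<pi> (b # w)) \<omega> = Some \<omega>"
      unfolding split using star_append[OF \<omega>(1) words IH(1)] letter(1) by simp
    moreover have "dot l\<^sub>1 (\<kappa> (\<pi> (b # w)) \<omega>) = Some l\<^sub>1"
      unfolding k_split using dot_append[OF base(1) letter(2) IH(2) letter(3)] IH(3) by simp
    moreover have "\<kappa> (\<pi> (b # w)) \<omega> \<in> lists A" unfolding k_split using letter(2) IH(2) by simp
    ultimately show ?case using cong by blast
  qed
  then show "star (\<pi> w) \<omega> = Some \<omega>" "\<kappa> (\<pi> w) \<omega> \<in> lists A"
    "dot l\<^sub>1 (\<kappa> (\<pi> w) \<omega>) = Some l\<^sub>1" "(w, \<phi> l\<^sub>1 (\<kappa> (\<pi> w) \<omega>)) \<in> mon_cong B relators"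
    by blast+
  show "\<pi> w \<in> lists A" using \<pi>_words assms .
qed

lemma kappa_h:
  shows "\<kappa> h \<eta> \<in> lists A" "dot l\<^sub>1 (\<kappa> h \<eta>) = Some l\<^sub>1"
    "word_val (schutzenberger S H) bval (\<phi> l\<^sub>1 (\<kappa> h \<eta>)) = sigma S H `` {\<one>}"
proof -
  show kl: "\<kappa> h \<eta> \<in> lists A" using kappa_lists[OF \<eta> h(1) star_h] .
  have eq: "val h \<otimes> val (\<kappa> h \<eta>) = val h \<otimes> \<one>"
    using kappa_val[OF \<eta> h(1) star_h] r_choice e[OF h(2)] h by simp
  then have St: "val (\<kappa> h \<eta>) \<in> Stab S H" using Stab_iff[OF h(2)] h kl by simp
  then show dot: "dot l\<^sub>1 (\<kappa> h \<eta>) = Some l\<^sub>1" using dot_base_Stab_iff kl by blast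
  show "word_val (schutzenberger S H) bval (\<phi> l\<^sub>1 (\<kappa> h \<eta>)) = sigma S H `` {\<one>}"
    using phi_val_base[OF kl dot] sigma_class_eq_iff[OF h(2) St Stab_one] eq by simp
qed

lemma relators_sound:
  assumes "(x, y) \<in> relators"
  shows "x \<in> lists B \<and> y \<in> lists B \<and>
    word_val (schutzenberger S H) bval x = word_val (schutzenberger S H) bval y"
  using assms unfolding relators_def
proof (elim UnE)
  assume "(x, y) \<in> {(\<phi> l u, \<phi> l v) | l u v. l \<in> \<Lambda> \<and> (u, v) \<in> Rules \<and> dot l u \<noteq> None}"
  then obtain l u v m where *: "x = \<phi> l u" "y = \<phi> l v" "l \<in> \<Lambda>" "(u, v) \<in> Rules" "dot l u = Some m"
    by auto
  have uv: "u \<in> lists A" "v \<in> lists A" "val u = val v" using * Rules_lists Rules_val by blast+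
  then have "dot l v = Some m" using * by simp
  then have "x \<in> lists B" "y \<in> lists B" using phi_lists uv * by blast+
  moreover obtain z where "z \<in> Hc l" using Hc_ne[OF *(3)] by blast
  from phi_val_cong[OF *(3) this uv(1) *(5) uv(2)] uv(3) *
  have "word_val (schutzenberger S H) bval x = word_val (schutzenberger S H) bval y" by simp
  ultimately show ?thesis by blast
next
  assume "(x, y) \<in> {(\<phi> l (\<kappa> u j), \<phi> l (\<kappa> v j)) | l j u v. l \<in> \<Lambda> \<and> j \<in> J \<and> (u, v) \<in> Rules \<and>
           star u j \<noteq> None \<and> Hc l \<subseteq> carrier S #> val (r (the (star u j)))}"
  then obtain l j u v i where *: "x = \<phi> l (\<kappa> u j)" "y = \<phi> l (\<kappa> v j)" "l \<in> \<Lambda>" "j \<in> I"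
    "(u, v) \<in> Rules" "star u j = Some i" "Hc l \<subseteq> carrier S #> val (r i)"
    by auto
  have uv: "u \<in> lists A" "v \<in> lists A" "val u = val v" using * Rules_lists Rules_val by blast+
  then have "star v j = Some i" using * by simp
  then have kl: "\<kappa> u j \<in> lists A" "\<kappa> v j \<in> lists A" using kappa_lists uv * by blast+
  obtain m where m: "dot l (\<kappa> u j) = Some m" using dot_kappa[OF *(3,4) uv(1) *(6,7)] by metis
  then have "dot l (\<kappa> v j) = Some m" using dot_kappa_cong[OF *(3,4) uv(1) *(6,7) uv(2,3)] by simp
  then have "x \<in> lists B" "y \<in> lists B" using phi_lists kl m * by blast+
  moreover obtain z where z: "z \<in> Hc l" using Hc_ne[OF *(3)] by blast
  have "word_val (schutzenberger S H) bval x = word_val (schutzenberger S H) bval y"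
    using phi_val_cong[OF *(3) z kl(1) m kl(2) mult_kappa_cong[OF z *(4) uv(1) *(6,7) uv(2,3)]] *
    by simp
  ultimately show ?thesis by blast
next
  assume "(x, y) \<in> {([(l, a)], \<phi> l\<^sub>1 (\<kappa> (\<pi> [(l, a)]) \<omega>)) | l a. l \<in> \<Lambda> \<and> a \<in> A \<and> dot l [a] \<noteq> None}"
  then obtain l a where *: "x = [(l, a)]" "y = \<phi> l\<^sub>1 (\<kappa> (\<pi> [(l, a)]) \<omega>)" "(l, a) \<in> B" by blast
  note letter = \<pi>_letter[OF *(3)]
  have "x \<in> lists B" unfolding *(1) using *(3) by (intro lists.intros)
  moreover have "y \<in> lists B" unfolding * using phi_lists[OF base(1) letter(2,3)] .
  moreover have "bval (l, a) \<in> carrier (schutzenberger S H)" using bval_closed *(3) by blast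
  then have "word_val (schutzenberger S H) bval x = bval (l, a)"
    unfolding *(1) monoid.word_val_Cons[OF monoid_schutzenberger]
      monoid.word_val_Nil[OF monoid_schutzenberger]
    by (rule monoid.r_one[OF monoid_schutzenberger])
  then have "word_val (schutzenberger S H) bval x = word_val (schutzenberger S H) bval y"
    unfolding *(2) letter(4) .
  ultimately show ?thesis by blast
next
  assume "(x, y) \<in> {([], \<phi> l\<^sub>1 (\<kappa> h \<eta>))}"
  then have *: "x = []" "y = \<phi> l\<^sub>1 (\<kappa> h \<eta>)" by auto
  show ?thesis
    unfolding * kappa_h(3) using phi_lists[OF base(1) kappa_h(1,2)]
    by (simp add: monoid.word_val_Nil[OF monoid_schutzenberger] schutzenberger_one)
qed

lemma relators_lists: "relators \<subseteq> lists B \<times> lists B"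
  using relators_sound by (intro subrelI) blast

lemma cong_sound:
  assumes "(u, v) \<in> mon_cong B relators"
  shows "word_val (schutzenberger S H) bval u = word_val (schutzenberger S H) bval v"
  using monoid.mon_cong_word_val[OF monoid_schutzenberger bval_closed relators_lists _ assms]
    relators_sound by blast

lemma word_val_kappa_\<pi>:
  assumes "w \<in> lists B"
  shows "word_val (schutzenberger S H) bval w = sigma S H `` {val (\<kappa> (\<pi> w) \<omega>)}"
  using cong_sound[OF \<pi>_word(5)[OF assms]] phi_val_base[OF \<pi>_word(3,4)[OF assms]] by (rule HOL.trans)

text \<open>By (R4) the factor \<open>\<phi>(1, \<kappa>(h, \<eta>))\<close> is trivial; adding it turns \<open>\<pi> w\<close>, whose value is not
  determined by that of \<open>w\<close>, into \<open>\<pi> w h\<close>, whose value is.\<close>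

lemma cong_kappa_h:
  assumes w: "w \<in> lists B"
  shows "(w, \<phi> l\<^sub>1 (\<kappa> (\<pi> w @ h) \<eta>)) \<in> mon_cong B relators"
    and "star (\<pi> w @ h) \<eta> = Some \<omega>"
proof -
  note word = \<pi>_word[OF w]
  show "star (\<pi> w @ h) \<eta> = Some \<omega>"
    using star_append[OF \<eta> word(1) h(1) star_h] word(2) by simp
  have "\<phi> l\<^sub>1 (\<kappa> (\<pi> w @ h) \<eta>) = \<phi> l\<^sub>1 (\<kappa> (\<pi> w) \<omega>) @ \<phi> l\<^sub>1 (\<kappa> h \<eta>)"
    unfolding kappa_append[OF \<eta> word(1) h(1) star_h]
    by (rule phi_append[OF base(1) word(3) kappa_h(1) word(4)])
  moreover have "([], \<phi> l\<^sub>1 (\<kappa> h \<eta>)) \<in> mon_cong B relators"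
    by (rule mon_cong.rule) (simp add: relators_def)
  from mon_cong.append[OF word(5) this]
  have "(w, \<phi> l\<^sub>1 (\<kappa> (\<pi> w) \<omega>) @ \<phi> l\<^sub>1 (\<kappa> h \<eta>)) \<in> mon_cong B relators"
    by (simp only: append_Nil2)
  ultimately show "(w, \<phi> l\<^sub>1 (\<kappa> (\<pi> w @ h) \<eta>)) \<in> mon_cong B relators" by (simp only:)
qed

lemma relators_complete:
  assumes w: "w \<in> lists B" "w' \<in> lists B"
    and eq: "word_val (schutzenberger S H) bval w = word_val (schutzenberger S H) bval w'"
  shows "(w, w') \<in> mon_cong B relators"
proof -
  note word = \<pi>_word[OF w(1)] and word' = \<pi>_word[OF w(2)]
  have St: "val (\<kappa> (\<pi> w) \<omega>) \<in> Stab S H" "val (\<kappa> (\<pi> w') \<omega>) \<in> Stab S H"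
    using dot_base_Stab_iff word(3,4) word'(3,4) by blast+
  have "val h \<otimes> val (\<kappa> (\<pi> w) \<omega>) = val h \<otimes> val (\<kappa> (\<pi> w') \<omega>)"
    using eq word_val_kappa_\<pi>[OF w(1)] word_val_kappa_\<pi>[OF w(2)] sigma_class_eq_iff[OF h(2) St]
    by simp
  then have "val (\<pi> w @ h) = val (\<pi> w' @ h)"
    using kappa_val[OF \<omega>(1) word(1,2)] kappa_val[OF \<omega>(1) word'(1,2)] r_choice
      val_append[OF word(1) h(1)] val_append[OF word'(1) h(1)] by simp
  then have "(\<pi> w @ h, \<pi> w' @ h) \<in> mon_cong A Rules"
    using val_eq_iff[of "\<pi> w @ h" "\<pi> w' @ h"] word(1) word'(1) h(1) by simp
  moreover have "(\<phi> l (\<kappa> u j), \<phi> l (\<kappa> v j)) \<in> mon_cong B relators"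
    if "l \<in> \<Lambda>" "j \<in> J" "(u, v) \<in> Rules" "star u j = Some i" "Hc l \<subseteq> carrier S #> val (r i)"
    for l j u v i
  proof -
    have "star u j \<noteq> None" "Hc l \<subseteq> carrier S #> val (r (the (star u j)))" using that by simp_all
    with that(1-3) have "(\<phi> l (\<kappa> u j), \<phi> l (\<kappa> v j)) \<in> relators"
      unfolding relators_def by blast
    then show ?thesis by (rule mon_cong.rule)
  qed
  moreover have "Hc l\<^sub>1 \<subseteq> carrier S #> val (r \<omega>)" using H_sub_h base r_choice by simp
  ultimately have "(\<phi> l\<^sub>1 (\<kappa> (\<pi> w @ h) \<eta>), \<phi> l\<^sub>1 (\<kappa> (\<pi> w' @ h) \<eta>)) \<in> mon_cong B relators"
    using phi_kappa_cong[OF Rules_lists Rules_val, where Q = relators]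
      base(1) \<eta>_J cong_kappa_h(2)[OF w(1)] by blast
  then show ?thesis
    by (rule mon_cong.trans[OF mon_cong.trans[OF cong_kappa_h(1)[OF w(1)]]
          mon_cong.sym[OF cong_kappa_h(1)[OF w(2)]]])
qed

lemma word_val_surj:
  "word_val (schutzenberger S H) bval ` lists B = carrier (schutzenberger S H)"
proof
  show "word_val (schutzenberger S H) bval ` lists B \<subseteq> carrier (schutzenberger S H)"
    using monoid.word_val_closed[OF monoid_schutzenberger bval_closed] by blast
  show "carrier (schutzenberger S H) \<subseteq> word_val (schutzenberger S H) bval ` lists B"
  proof
    fix X assume "X \<in> carrier (schutzenberger S H)"
    then obtain s where s: "s \<in> Stab S H" "X = sigma S H `` {s}"
      by (rule schutzenberger_carrierE)
    then obtain w where w: "w \<in> lists A" "s = val w" using val_surj Stab_carrier by blast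
    have dot: "dot l\<^sub>1 w = Some l\<^sub>1" using dot_base_Stab_iff w s by blast
    have "X = word_val (schutzenberger S H) bval (\<phi> l\<^sub>1 w)" by (simp only: s(2) w(2) phi_val_base[OF w(1) dot])
    then show "X \<in> word_val (schutzenberger S H) bval ` lists B"
      using phi_lists[OF base(1) w(1) dot] by blast
  qed
qed

lemma presentation: "defined_by_presentation (schutzenberger S H) bval B relators"
  unfolding defined_by_presentation_def
proof (intro conjI ballI)
  fix u v assume "u \<in> lists B" "v \<in> lists B"
  then show "word_val (schutzenberger S H) bval u = word_val (schutzenberger S H) bval v \<longleftrightarrow>
      (u, v) \<in> mon_cong B relators"
    using relators_complete cong_sound by (intro iffI)
qed (rule monoid_schutzenberger bval_closed relators_lists word_val_surj)+

end

theorem theorem2: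
  fixes S :: "('s, 'm) monoid_scheme" (structure)
    and A :: "'a set" and gen :: "'a \<Rightarrow> 's" and Rules :: "('a list \<times> 'a list) set"
    and H R :: "'s set" and h e :: "'a list"
    and \<Lambda> :: "'l set" and Hc :: "'l \<Rightarrow> 's set" and l\<^sub>1 :: 'l and p p' :: "'l \<Rightarrow> 'a list"
    and \<pi> :: "('l \<times> 'a) list \<Rightarrow> 'a list"
    and I :: "'i set" and Rc :: "'i \<Rightarrow> 's set" and \<omega> \<eta> :: 'i and r :: "'i \<Rightarrow> 'a list"
    and k :: "'a \<Rightarrow> 'i \<Rightarrow> 'a list"
  defines "val \<equiv> word_val S gen"
    and "dot \<equiv> (\<lambda>l w. H_act S \<Lambda> Hc l (word_val S gen w))"
    and "star \<equiv> (\<lambda>w i. R_act S I Rc (word_val S gen w) i)"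
  defines "\<phi> \<equiv> phi_word dot"
    and "\<kappa> \<equiv> kappa_word star k"
    and "B \<equiv> {(l, a). l \<in> \<Lambda> \<and> a \<in> A \<and> dot l [a] \<noteq> None}"
    and "J \<equiv> {j \<in> I. \<exists>s\<in>carrier S. Rc j = R_star S s (Rc \<eta>)}"
  assumes S: "defined_by_presentation S gen A Rules"
    and H: "H \<in> carrier S // green_H S"
    and R: "R \<in> carrier S // green_R S" "H \<subseteq> R"
    and h: "h \<in> lists A" "val h \<in> H"
    and Hc: "bij_betw Hc \<Lambda> {H' \<in> carrier S // green_H S. H' \<subseteq> R}"
    and base: "l\<^sub>1 \<in> \<Lambda>" "Hc l\<^sub>1 = H"
    and p_words: "\<And>l. l \<in> \<Lambda> \<Longrightarrow> p l \<in> lists A" "\<And>l. l \<in> \<Lambda> \<Longrightarrow> p' l \<in> lists A"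
    and p: "\<And>l. l \<in> \<Lambda> \<Longrightarrow> H #> val (p l) = Hc l"
    and pp': "\<And>l x. l \<in> \<Lambda> \<Longrightarrow> x \<in> H \<Longrightarrow> x \<otimes> val (p l) \<otimes> val (p' l) = x"
    and p'p: "\<And>l x. l \<in> \<Lambda> \<Longrightarrow> x \<in> Hc l \<Longrightarrow> x \<otimes> val (p' l) \<otimes> val (p l) = x"
    and p1: "p l\<^sub>1 = []" "p' l\<^sub>1 = []"
    and \<pi>_hom: "\<And>u v. u \<in> lists B \<Longrightarrow> v \<in> lists B \<Longrightarrow> \<pi> (u @ v) = \<pi> u @ \<pi> v"
    and \<pi>_words: "\<And>u. u \<in> lists B \<Longrightarrow> \<pi> u \<in> lists A"
    and \<pi>: "\<And>l a. (l, a) \<in> B \<Longrightarrow>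
          val (h @ p l @ [a] @ p' (the (dot l [a]))) = val (\<pi> [(l, a)] @ h)"
    and Rc: "bij_betw Rc I {R' \<in> carrier S // green_R S. \<exists>s\<in>carrier S. R_star S s R' = R}"
    and e: "e \<in> lists A" "\<And>x. x \<in> H \<Longrightarrow> x \<otimes> val e = x"
    and \<omega>: "\<omega> \<in> I" "Rc \<omega> = R"
    and \<eta>: "\<eta> \<in> I" "val e \<in> Rc \<eta>"
    and r: "\<And>i. i \<in> I \<Longrightarrow> r i \<in> lists A" "\<And>i. i \<in> I \<Longrightarrow> val (r i) \<in> Rc i"
    and r_choice: "r \<omega> = h" "r \<eta> = e" "\<And>i. i \<in> I \<Longrightarrow> \<one> \<in> Rc i \<Longrightarrow> r i = []"
    and k_words: "\<And>a i. a \<in> A \<Longrightarrow> i \<in> I \<Longrightarrow> star [a] i \<noteq> None \<Longrightarrow> k a i \<in> lists A"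
    and k: "\<And>a i. a \<in> A \<Longrightarrow> i \<in> I \<Longrightarrow> star [a] i \<noteq> None \<Longrightarrow>
          val (a # r i) = val (r (the (star [a] i)) @ k a i)"
  shows "defined_by_presentation (schutzenberger S H)
     (\<lambda>(l, a). sigma S H `` {val (p l @ [a] @ p' (the (dot l [a])))})
     B
     ({(\<phi> l u, \<phi> l v) | l u v. l \<in> \<Lambda> \<and> (u, v) \<in> Rules \<and> dot l u \<noteq> None}
      \<union> {(\<phi> l (\<kappa> u j), \<phi> l (\<kappa> v j)) | l j u v. l \<in> \<Lambda> \<and> j \<in> J \<and> (u, v) \<in> Rules \<and>
           star u j \<noteq> None \<and> Hc l \<subseteq> carrier S #> val (r (the (star u j)))}
      \<union> {([(l, a)], \<phi> l\<^sub>1 (\<kappa> (\<pi> [(l, a)]) \<omega>)) | l a. l \<in> \<Lambda> \<and> a \<in> A \<and> dot l [a] \<noteq> None}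
      \<union> {([], \<phi> l\<^sub>1 (\<kappa> h \<eta>))})"
proof -
  have "monoid S" "gen \<in> A \<rightarrow> carrier S" using S by (simp_all add: defined_by_presentation_def)
  then interpret schutzenberger_presentation S A gen H R h e \<Lambda> Hc l\<^sub>1 p p' I Rc \<omega> \<eta> r k Rules \<pi>
    using S H R h Hc base p_words p pp' p'p p1 \<pi>_hom \<pi>_words \<pi> Rc e(2) \<omega> \<eta>(1) r r_choice(1,2) k_words k
    unfolding val_def dot_def star_def B_def
    by (intro schutzenberger_presentation.intro schutzenberger_rewriting.intro
        schutzenberger_rewriting_axioms.intro schutzenberger_presentation_axioms.intro) assumption+
  show ?thesis
    unfolding \<phi>_def \<kappa>_def B_def J_def dot_def star_def val_def by (rule presentation[unfolded relators_def])
qed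

end
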